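(* Let $\delta_1,\delta_2,\delta_3$ be real numbers satisfying $$2(\delta_3-\delta_2)+(\delta_1-\delta_2)^->0,\qquad 2(\delta_2-\delta_1)+(\delta_2-\delta_3)^->0 ,$$ and let $\boldsymbol\pi$ be the unique invariant probability measure of the gap process $(G(\cdot),H(\cdot))$ described in the context. Then the joint distribution $\boldsymbol\pi$ of the two gaps is not the product of its two marginal distributions.
   Context: Here $x^-=\max(-x,0)$. Let $W(\cdot)$ be a standard scalar Brownian motion and $x_1>x_2>x_3$ real numbers. The process $(G(\cdot),H(\cdot))$ is the continuous $[0,\infty)^2$-valued process $$G(t)=x_1-x_2-(\delta_2-\delta_1)t-W(t)-\tfrac12\Gamma(t)+A(t),$$ $$H(t)=x_2-x_3-(\delta_3-\delta_2)t+W(t)-\tfrac12A(t)+\Gamma(t),$$ where $(A,\Gamma)$ is the unique pair of continuous, nondecreasing, $W$-adapted processes with $A(0)=\Gamma(0)=0$ and $$A(t)=\max_{0\le s\le t}\big(-(x_1-x_2)+(\delta_2-\delta_1)s+W(s)+\tfrac12\Gamma(s)\big)^+,$$ $$\Gamma(t)=\max_{0\le s\le t}\big(-(x_2-x_3)+(\delta_3-\delta_2)s-W(s)+\tfrac12A(s)\big)^+.$$ Under the stated conditions on the $\delta_i$ this Markov process is positive recurrent and has a unique invariant probability measure $\boldsymbol\pi$, with $\boldsymbol\pi((0,\infty)^2)=1$. *)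

theory Defs
  imports "HOL-Probability.Probability"
begin

definition neg_part :: "real \<Rightarrow> real" where
  "neg_part x = max (- x) 0"

definition natural_filtration :: "'a measure \<Rightarrow> (real \<Rightarrow> 'a \<Rightarrow> real) \<Rightarrow> real \<Rightarrow> 'a measure" where
  "natural_filtration M W t =
     sigma (space M) {W s -` B \<inter> space M | s B. s \<in> {0..t} \<and> B \<in> sets borel}"

(* Only times t >= 0 matter. As usual for continuous processes, W 0 = 0 and
   continuity are required of every path, so that the Skorokhod equations below
   can be solved path by path without completing the filtration. *)
locale standard_brownian_motion = prob_space M for M :: "'a measure" +
  fixes W :: "real \<Rightarrow> 'a \<Rightarrow> real"
  assumes W_measurable: "\<And>t. 0 \<le> t \<Longrightarrow> W t \<in> borel_measurable M"
    and W_start: "\<And>\<omega>. \<omega> \<in> space M \<Longrightarrow> W 0 \<omega> = 0"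
    and W_continuous: "\<And>\<omega>. \<omega> \<in> space M \<Longrightarrow> continuous_on {0..} (\<lambda>t. W t \<omega>)"
    and W_increment_normal: "\<And>s t. 0 \<le> s \<Longrightarrow> s < t \<Longrightarrow>
          distributed M lborel (\<lambda>\<omega>. W t \<omega> - W s \<omega>) (normal_density 0 (sqrt (t - s)))"
    and W_increment_indep: "\<And>s t. 0 \<le> s \<Longrightarrow> s < t \<Longrightarrow>
          indep_set (sets (natural_filtration M W s))
                    {(\<lambda>\<omega>. W t \<omega> - W s \<omega>) -` B \<inter> space M | B. B \<in> sets borel}"

definition continuous_increasing_adapted ::
    "'a measure \<Rightarrow> (real \<Rightarrow> 'a \<Rightarrow> real) \<Rightarrow> (real \<Rightarrow> 'a \<Rightarrow> real) \<Rightarrow> bool" where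
  "continuous_increasing_adapted M W A \<longleftrightarrow>
     (\<forall>t\<ge>0. A t \<in> borel_measurable (natural_filtration M W t)) \<and>
     (\<forall>\<omega>\<in>space M. continuous_on {0..} (\<lambda>t. A t \<omega>) \<and> mono_on {0..} (\<lambda>t. A t \<omega>) \<and> A 0 \<omega> = 0)"

(* The initial gaps are g = x1 - x2 and h = x2 - x3. The suprema are over
   continuous functions on the compact interval {0..t}, hence are maxima. *)
definition collision_local_times ::
    "'a measure \<Rightarrow> (real \<Rightarrow> 'a \<Rightarrow> real) \<Rightarrow> real \<Rightarrow> real \<Rightarrow> real \<Rightarrow> real \<Rightarrow> real \<Rightarrow>
     (real \<Rightarrow> 'a \<Rightarrow> real) \<Rightarrow> (real \<Rightarrow> 'a \<Rightarrow> real) \<Rightarrow> bool" where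
  "collision_local_times M W \<delta>\<^sub>1 \<delta>\<^sub>2 \<delta>\<^sub>3 g h A \<Gamma> \<longleftrightarrow>
     continuous_increasing_adapted M W A \<and>
     continuous_increasing_adapted M W \<Gamma> \<and>
     (\<forall>\<omega>\<in>space M. \<forall>t\<ge>0.
        A t \<omega> = (SUP s\<in>{0..t}. max 0 (- g + (\<delta>\<^sub>2 - \<delta>\<^sub>1) * s + W s \<omega> + \<Gamma> s \<omega> / 2)) \<and>
        \<Gamma> t \<omega> = (SUP s\<in>{0..t}. max 0 (- h + (\<delta>\<^sub>3 - \<delta>\<^sub>2) * s - W s \<omega> + A s \<omega> / 2)))"

definition gap_process ::
    "(real \<Rightarrow> 'a \<Rightarrow> real) \<Rightarrow> real \<Rightarrow> real \<Rightarrow> real \<Rightarrow> real \<Rightarrow> real \<Rightarrow>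
     (real \<Rightarrow> 'a \<Rightarrow> real) \<Rightarrow> (real \<Rightarrow> 'a \<Rightarrow> real) \<Rightarrow> real \<Rightarrow> 'a \<Rightarrow> real \<times> real" where
  "gap_process W \<delta>\<^sub>1 \<delta>\<^sub>2 \<delta>\<^sub>3 g h A \<Gamma> t \<omega> =
     (g - (\<delta>\<^sub>2 - \<delta>\<^sub>1) * t - W t \<omega> - \<Gamma> t \<omega> / 2 + A t \<omega>,
      h - (\<delta>\<^sub>3 - \<delta>\<^sub>2) * t + W t \<omega> - A t \<omega> / 2 + \<Gamma> t \<omega>)"

abbreviation quadrant :: "(real \<times> real) set" where
  "quadrant \<equiv> {0..} \<times> {0..}"

(* A g h and \<Gamma> g h are the regulating processes for the initial gaps (g, h), so the
   inner emeasure is the transition probability from (g, h) into B at time t. *)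
definition invariant_gap_distribution ::
    "'a measure \<Rightarrow> (real \<Rightarrow> 'a \<Rightarrow> real) \<Rightarrow> real \<Rightarrow> real \<Rightarrow> real \<Rightarrow>
     (real \<Rightarrow> real \<Rightarrow> real \<Rightarrow> 'a \<Rightarrow> real) \<Rightarrow> (real \<Rightarrow> real \<Rightarrow> real \<Rightarrow> 'a \<Rightarrow> real) \<Rightarrow>
     (real \<times> real) measure \<Rightarrow> bool" where
  "invariant_gap_distribution M W \<delta>\<^sub>1 \<delta>\<^sub>2 \<delta>\<^sub>3 A \<Gamma> \<pi> \<longleftrightarrow>
     prob_space \<pi> \<and> sets \<pi> = sets borel \<and> emeasure \<pi> quadrant = 1 \<and>
     (\<forall>t\<ge>0. \<forall>B\<in>sets borel.
        emeasure \<pi> B =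
          (\<integral>\<^sup>+x\<in>quadrant.
             emeasure M {\<omega> \<in> space M.
               gap_process W \<delta>\<^sub>1 \<delta>\<^sub>2 \<delta>\<^sub>3 (fst x) (snd x) (A (fst x) (snd x)) (\<Gamma> (fst x) (snd x)) t \<omega> \<in> B}
           \<partial>\<pi>))"

end

theory Submission imports Defs begin

text \<open>
  Write \<open>a = \<delta>\<^sub>2 - \<delta>\<^sub>1\<close>, \<open>b = \<delta>\<^sub>3 - \<delta>\<^sub>2\<close> and let \<open>\<phi>(x,y)\<close> be the Laplace transform of the
  invariant law of \<open>(G,H)\<close>. Both gaps are driven by the same noise, with opposite signs, so
  Ito's formula for \<open>exp (- (x G + y H))\<close> in the stationary regime gives the adjoint relation
  \<open>((x - y)\<^sup>2 / 2 + a x + b y) \<phi>(x,y) = (x - y/2) F\<^sub>A(y) + (y - x/2) F\<^sub>\<Gamma>(x)\<close>,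
  where \<open>F\<^sub>A\<close> and \<open>F\<^sub>\<Gamma>\<close> are the Laplace transforms of the two boundary measures, on \<open>G = 0\<close>
  and on \<open>H = 0\<close>. Suppose \<open>\<phi>(x,y) = u(x) v(y)\<close>. Setting \<open>y = 0\<close> and \<open>x = 0\<close> expresses
  \<open>F\<^sub>\<Gamma>\<close> through \<open>u\<close> and \<open>F\<^sub>A\<close> through \<open>v\<close>; letting \<open>y \<rightarrow> \<infinity>\<close> for fixed \<open>x\<close> then forces \<open>u\<close> to be
  the transform of an exponential law, and likewise \<open>v\<close>. With exponential marginals the
  relation is an identity of polynomials which, after a common factor is cancelled, has the
  coefficient \<open>-2\<close> of \<open>x y\<close> on one side and \<open>-1\<close> on the other: the skew-symmetry condition for a product form fails. This algebraic
  half is \<open>no_product_solution\<close>.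

  The adjoint relation is obtained without stochastic integration. Stationarity says that
  \<open>exp (- (x G + y H))\<close> has the same expectation at time \<open>0\<close> and at a single short time \<open>t\<close>,
  and a second-order Taylor expansion of the increment gives the relation up to an error
  that vanishes with \<open>t\<close> (\<open>stationary_step.basic_relation\<close>, \<open>adjoint_relation\<close>). Here \<open>F\<^sub>A\<close> and \<open>F\<^sub>\<Gamma>\<close>
  appear as limits of the expected weighted push during \<open>[0,t]\<close> divided by \<open>t\<close>. Three estimates
  control the error. The maximum of \<open>|W|\<close> over \<open>[0,t]\<close> has a fourth moment of order \<open>t\<^sup>2\<close>
  (\<open>maximal_bound\<close>, by dyadic chaining). The Skorokhod equations bound the pushes by a
  multiple of that maximum, and a push can occur only if the pushed gap starts within that
  distance of \<open>0\<close> (\<open>regulator_bounds\<close>). Finally \<open>G + H\<close> does not see the noise, so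
  stationarity alone bounds the expected pushes by a multiple of \<open>t\<close> (\<open>mean_push_le\<close>); this
  is smaller than the typical size \<open>sqrt t\<close> of the noise and makes all terms involving a
  push together with a noise increment negligible.
\<close>

section \<open>A maximal inequality for Brownian motion\<close>

text \<open>A point of level \<open>n + 1\<close> is either of level \<open>n\<close> or one increment of level \<open>n + 1\<close> away
  from one, so the path reaches it from \<open>0\<close> with at most one increment of each level.\<close>
lemma dyadic_chaining:
  fixes w :: "real \<Rightarrow> real"
  assumes w0: "w 0 = 0" and q: "0 \<le> q"
    and incr: "\<And>n k. k < 2 ^ n \<Longrightarrow> \<bar>w (real (Suc k) * t / 2 ^ n) - w (real k * t / 2 ^ n)\<bar> \<le> v * q ^ n"
  shows "k \<le> 2 ^ n \<Longrightarrow> \<bar>w (real k * t / 2 ^ n)\<bar> \<le> v * (\<Sum>m\<le>n. q ^ m)"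
proof (induction n arbitrary: k)
  case 0
  have "0 \<le> v" using incr[of 0 0] by (simp add: w0)
  then show ?case using 0 incr[of 0 0] by (cases k) (auto simp: w0)
next
  case (Suc n)
  have "0 \<le> v" using incr[of 0 0] by (simp add: w0)
  show ?case
  proof (cases "even k")
    case True
    then obtain j where k: "k = 2 * j" by blast
    then have "\<bar>w (real j * t / 2 ^ n)\<bar> \<le> v * (\<Sum>m\<le>n. q ^ m)" using Suc by auto
    also have "\<dots> \<le> v * (\<Sum>m\<le>Suc n. q ^ m)" using \<open>0 \<le> v\<close> q by (intro mult_left_mono) auto
    finally show ?thesis by (simp add: k)
  next
    case False
    then obtain j where k: "k = 2 * j + 1" by (elim oddE)
    have j: "j \<le> 2 ^ n" "2 * j < 2 ^ Suc n" using Suc.prems k by auto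
    have "\<bar>w (real j * t / 2 ^ n)\<bar> \<le> v * (\<Sum>m\<le>n. q ^ m)" by (rule Suc.IH[OF j(1)])
    moreover have "\<bar>w (real k * t / 2 ^ Suc n) - w (real j * t / 2 ^ n)\<bar> \<le> v * q ^ Suc n"
      using incr[OF j(2)] by (simp add: k add_ac)
    ultimately have "\<bar>w (real k * t / 2 ^ Suc n)\<bar> \<le> v * (\<Sum>m\<le>n. q ^ m) + v * q ^ Suc n" by linarith
    then show ?thesis by (simp add: distrib_left)
  qed
qed

lemma chaining_bound:
  fixes w :: "real \<Rightarrow> real"
  assumes w0: "w 0 = 0" and cont: "continuous_on {0..} w" and t: "0 < t" and q: "0 \<le> q" "q < 1"
    and incr: "\<And>n k. k < 2 ^ n \<Longrightarrow> \<bar>w (real (Suc k) * t / 2 ^ n) - w (real k * t / 2 ^ n)\<bar> \<le> v * q ^ n"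
    and s: "0 \<le> s" "s \<le> t"
  shows "\<bar>w s\<bar> \<le> v / (1 - q)"
proof -
  have v: "0 \<le> v" using incr[of 0 0] by (simp add: w0)
  \<comment> \<open>the largest dyadic point of level \<open>n\<close> below \<open>s\<close>\<close>
  define d where "d n = real (nat \<lfloor>2 ^ n * (s / t)\<rfloor>) * t / 2 ^ n" for n
  have d_eq: "d n = of_int \<lfloor>2 ^ n * (s / t)\<rfloor> * t / 2 ^ n" for n
    unfolding d_def using s t by simp
  have "(\<lambda>n. d n) \<longlonglongrightarrow> s"
  proof (rule real_tendsto_sandwich)
    show "\<forall>\<^sub>F n in sequentially. s - t * (1 / 2) ^ n \<le> d n"
    proof (rule always_eventually, rule allI)
      fix n
      have "2 ^ n * (s / t) - 1 \<le> of_int \<lfloor>2 ^ n * (s / t)\<rfloor>" by linarith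
      then have "(2 ^ n * (s / t) - 1) * (t / 2 ^ n) \<le> of_int \<lfloor>2 ^ n * (s / t)\<rfloor> * (t / 2 ^ n)"
        using t by (intro mult_right_mono) auto
      moreover have "(2 ^ n * (s / t) - 1) * (t / 2 ^ n) = s - t * (1 / 2) ^ n"
        using t by (simp add: field_simps power_divide)
      ultimately show "s - t * (1 / 2) ^ n \<le> d n" unfolding d_eq by simp
    qed
    show "\<forall>\<^sub>F n in sequentially. d n \<le> s"
    proof (rule always_eventually, rule allI)
      fix n
      have "of_int \<lfloor>2 ^ n * (s / t)\<rfloor> \<le> 2 ^ n * (s / t)" by linarith
      from mult_right_mono[OF this, of "t / 2 ^ n"]
      show "d n \<le> s" unfolding d_eq using t by (simp add: field_simps)
    qed
    have "(\<lambda>n. s - t * (1 / 2) ^ n) \<longlonglongrightarrow> s - t * 0"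
      by (intro tendsto_intros LIMSEQ_power_zero) auto
    then show "(\<lambda>n. s - t * (1 / 2) ^ n) \<longlonglongrightarrow> s" by simp
  qed simp
  moreover have "d n \<in> {0..}" for n unfolding d_def using t by auto
  ultimately have "(\<lambda>n. w (d n)) \<longlonglongrightarrow> w s"
    using cont s(1) unfolding continuous_on_sequentially comp_def by auto
  then have "(\<lambda>n. \<bar>w (d n)\<bar>) \<longlonglongrightarrow> \<bar>w s\<bar>" by (rule tendsto_rabs)
  moreover have "\<bar>w (d n)\<bar> \<le> v / (1 - q)" for n
  proof -
    have "2 ^ n * (s / t) \<le> 2 ^ n" using s t by (simp add: field_simps)
    then have "nat \<lfloor>2 ^ n * (s / t)\<rfloor> \<le> 2 ^ n"
      by (metis floor_mono floor_numeral_power nat_le_iff of_nat_numeral of_nat_power)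
    then have "\<bar>w (d n)\<bar> \<le> v * (\<Sum>m\<le>n. q ^ m)"
      unfolding d_def by (intro dyadic_chaining w0 q(1) incr)
    also have "(\<Sum>m\<le>n. q ^ m) \<le> (\<Sum>m. q ^ m)"
      using q by (intro sum_le_suminf summable_geometric) auto
    also have "(\<Sum>m. q ^ m) = 1 / (1 - q)" using q by (intro suminf_geometric) auto
    finally show ?thesis using v by (simp add: mult_left_mono)
  qed
  ultimately show ?thesis by (intro tendsto_upperbound[of _ _ sequentially]) (auto simp: always_eventually)
qed

context standard_brownian_motion
begin

text \<open>The fourth moment feeds the chaining bound; the second and the first produce the
  diffusion term and the vanishing martingale term of the expansion.\<close>
lemma increment_moments:
  assumes "0 \<le> s" "s < t"
  shows "integrable M (\<lambda>\<omega>. (W t \<omega> - W s \<omega>) ^ 4)" "(\<integral>\<omega>. (W t \<omega> - W s \<omega>) ^ 4 \<partial>M) = 3 * (t - s)\<^sup>2"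
    and "integrable M (\<lambda>\<omega>. (W t \<omega> - W s \<omega>)\<^sup>2)" "(\<integral>\<omega>. (W t \<omega> - W s \<omega>)\<^sup>2 \<partial>M) = t - s"
    and "integrable M (\<lambda>\<omega>. W t \<omega> - W s \<omega>)" "(\<integral>\<omega>. W t \<omega> - W s \<omega> \<partial>M) = 0"
proof -
  let ?N = "normal_density 0 (sqrt (t - s))"
  have D: "distributed M lborel (\<lambda>\<omega>. W t \<omega> - W s \<omega>) ?N"
    by (rule W_increment_normal[OF assms])
  have pos: "0 < sqrt (t - s)" "0 \<le> t - s" using assms by auto
  have int: "integrable M (\<lambda>\<omega>. f (W t \<omega> - W s \<omega>)) \<and> (\<integral>\<omega>. f (W t \<omega> - W s \<omega>) \<partial>M) = c"
    if "has_bochner_integral lborel (\<lambda>x. ?N x * f x) c" "f \<in> borel_measurable borel" for f c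
    using distributed_integrable[OF D, of f] distributed_integral[OF D, of f] that
    by (auto simp: has_bochner_integral_iff)
  have 4: "has_bochner_integral lborel (\<lambda>x. ?N x * x ^ 4) (3 * (t - s)\<^sup>2)"
    using normal_moment_even[OF pos(1), of 0 2] pos(2)
    by (simp add: fact_numeral power_divide power2_eq_square)
  have 2: "has_bochner_integral lborel (\<lambda>x. ?N x * x\<^sup>2) (t - s)"
    using normal_moment_even[OF pos(1), of 0 1] pos(2) by (simp add: fact_numeral diff_divide_distrib)
  have 1: "has_bochner_integral lborel (\<lambda>x. ?N x * x) 0"
    using normal_moment_odd[OF pos(1), of 0 0] by simp
  show "integrable M (\<lambda>\<omega>. (W t \<omega> - W s \<omega>) ^ 4)" "(\<integral>\<omega>. (W t \<omega> - W s \<omega>) ^ 4 \<partial>M) = 3 * (t - s)\<^sup>2"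
    using int[OF 4] by auto
  show "integrable M (\<lambda>\<omega>. (W t \<omega> - W s \<omega>)\<^sup>2)" "(\<integral>\<omega>. (W t \<omega> - W s \<omega>)\<^sup>2 \<partial>M) = t - s"
    using int[OF 2] by auto
  show "integrable M (\<lambda>\<omega>. W t \<omega> - W s \<omega>)" "(\<integral>\<omega>. W t \<omega> - W s \<omega> \<partial>M) = 0"
    using int[OF 1] by auto
qed

text \<open>The sum of the fourth powers of the \<open>2 ^ n\<close> increments
  of level \<open>n\<close> has expectation \<open>3 t\<^sup>2 / 2 ^ n\<close>, so the sum \<open>V\<close> of these quantities with weights
  \<open>(9/8) ^ (4 n)\<close> still has expectation of order \<open>t\<^sup>2\<close>. Every increment of level \<open>n\<close> is at
  most \<open>(8/9) ^ n\<close> times the fourth root of \<open>V\<close>, and these bounds are summable.\<close>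
lemma maximal_bound:
  assumes t: "0 < t"
  obtains N where "N \<in> borel_measurable M" "\<And>\<omega>. 0 \<le> N \<omega>"
    and "AE \<omega> in M. \<forall>s\<in>{0..t}. \<bar>W s \<omega>\<bar> \<le> N \<omega>"
    and "integrable M (\<lambda>\<omega>. N \<omega> ^ 4)" "(\<integral>\<omega>. N \<omega> ^ 4 \<partial>M) \<le> 100000 * t\<^sup>2"
proof -
  \<comment> \<open>\<open>6561 / 4096 = (9 / 8) ^ 4\<close>, and \<open>6561 / 8192 < 1\<close> is that weight times the decay \<open>1 / 2\<close> of the levels\<close>
  define X where "X n k \<omega> = W (real (Suc k) * t / 2 ^ n) \<omega> - W (real k * t / 2 ^ n) \<omega>" for n k \<omega>
  have X_meas[measurable]: "X n k \<in> borel_measurable M" for n k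
    unfolding X_def using t by (intro borel_measurable_diff W_measurable) auto
  define V where "V \<omega> = (\<Sum>n. ennreal ((6561 / 4096) ^ n * (\<Sum>k<2 ^ n. X n k \<omega> ^ 4)))" for \<omega>
  have V_meas[measurable]: "V \<in> borel_measurable M" unfolding V_def by measurable
  have X4: "integrable M (\<lambda>\<omega>. X n k \<omega> ^ 4)" "(\<integral>\<omega>. X n k \<omega> ^ 4 \<partial>M) = 3 * (t / 2 ^ n)\<^sup>2" for n k
    using increment_moments(1,2)[of "real k * t / 2 ^ n" "real (Suc k) * t / 2 ^ n"] t
    unfolding X_def by (auto simp: field_simps)
  have level: "(\<integral>\<^sup>+\<omega>. ennreal ((6561 / 4096) ^ n * (\<Sum>k<2 ^ n. X n k \<omega> ^ 4)) \<partial>M) = ennreal (3 * t\<^sup>2 * (6561 / 8192) ^ n)" for n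
  proof -
    have "(\<integral>\<^sup>+\<omega>. ennreal ((6561 / 4096) ^ n * (\<Sum>k<2 ^ n. X n k \<omega> ^ 4)) \<partial>M)
        = ennreal (\<integral>\<omega>. (6561 / 4096) ^ n * (\<Sum>k<2 ^ n. X n k \<omega> ^ 4) \<partial>M)"
      using X4 by (intro nn_integral_eq_integral) (auto intro!: mult_nonneg_nonneg sum_nonneg)
    also have "(\<integral>\<omega>. (6561 / 4096) ^ n * (\<Sum>k<2 ^ n. X n k \<omega> ^ 4) \<partial>M) = (6561 / 4096) ^ n * (2 ^ n * (3 * (t / 2 ^ n)\<^sup>2))"
      using X4 by simp
    also have "\<dots> = 3 * t\<^sup>2 * ((6561 / 4096) ^ n * (1 / 2) ^ n)"
      by (simp add: power2_eq_square power_divide)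
    also have "(6561 / 4096) ^ n * (1 / 2) ^ n = (6561 / 8192 :: real) ^ n"
      by (subst power_mult_distrib[symmetric]) simp
    finally show ?thesis .
  qed
  have sums: "(\<lambda>n. 3 * t\<^sup>2 * (6561 / 8192) ^ n) sums (3 * t\<^sup>2 * (8192 / 1631))"
    using sums_mult[OF geometric_sums[of "6561 / 8192 :: real"], of "3 * t\<^sup>2"] by simp
  have EV: "(\<integral>\<^sup>+\<omega>. V \<omega> \<partial>M) = ennreal (3 * t\<^sup>2 * (8192 / 1631))"
  proof -
    have "(\<integral>\<^sup>+\<omega>. V \<omega> \<partial>M) = (\<Sum>n. ennreal (3 * t\<^sup>2 * (6561 / 8192) ^ n))"
      unfolding V_def by (subst nn_integral_suminf) (auto simp: level)
    also have "\<dots> = ennreal (3 * t\<^sup>2 * (8192 / 1631))"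
      by (subst suminf_ennreal2[OF _ sums_summable[OF sums]]) (simp_all only: sums_unique[OF sums, symmetric], simp)
    finally show ?thesis .
  qed
  define N where "N \<omega> = 9 * root 4 (enn2real (V \<omega>))" for \<omega>
  have N4: "N \<omega> ^ 4 = 6561 * enn2real (V \<omega>)" for \<omega>
    unfolding N_def by (simp add: power_mult_distrib)
  have fin: "AE \<omega> in M. V \<omega> \<noteq> \<infinity>"
    using EV by (intro nn_integral_PInf_AE) auto
  have EV': "(\<integral>\<^sup>+\<omega>. ennreal (enn2real (V \<omega>)) \<partial>M) = ennreal (3 * t\<^sup>2 * (8192 / 1631))"
    unfolding EV[symmetric] using fin
    by (intro nn_integral_cong_AE) (auto simp: less_top[symmetric] elim!: eventually_mono)
  have int: "has_bochner_integral M (\<lambda>\<omega>. enn2real (V \<omega>)) (3 * t\<^sup>2 * (8192 / 1631))"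
    by (rule has_bochner_integral_nn_integral) (auto simp: EV')
  show thesis
  proof
    show "N \<in> borel_measurable M" unfolding N_def by measurable
    show "0 \<le> N \<omega>" for \<omega> unfolding N_def by simp
    show "integrable M (\<lambda>\<omega>. N \<omega> ^ 4)" unfolding N4 using int by (auto simp: has_bochner_integral_iff)
    show "(\<integral>\<omega>. N \<omega> ^ 4 \<partial>M) \<le> 100000 * t\<^sup>2"
    proof -
      have "(\<integral>\<omega>. N \<omega> ^ 4 \<partial>M) = 6561 * (3 * t\<^sup>2 * (8192 / 1631))"
        unfolding N4 has_bochner_integral_integral_eq[OF int, symmetric] by simp
      also have "\<dots> \<le> 100000 * t\<^sup>2" using zero_le_power2[of t] by linarith
      finally show ?thesis .
    qed
    show "AE \<omega> in M. \<forall>s\<in>{0..t}. \<bar>W s \<omega>\<bar> \<le> N \<omega>"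
      using fin AE_space
    proof eventually_elim
      case (elim \<omega>)
      define v where "v = root 4 (enn2real (V \<omega>))"
      have v: "0 \<le> v" "ennreal (v ^ 4) = V \<omega>" using elim by (auto simp: v_def less_top[symmetric])
      have incr: "\<bar>W (real (Suc k) * t / 2 ^ n) \<omega> - W (real k * t / 2 ^ n) \<omega>\<bar> \<le> v * (8 / 9) ^ n"
        if k: "k < 2 ^ n" for n k
      proof -
        have "ennreal ((6561 / 4096) ^ n * (\<Sum>k<2 ^ n. X n k \<omega> ^ 4)) \<le> V \<omega>"
          unfolding V_def using sum_le_suminf[OF summableI, of "{n}" "\<lambda>n. ennreal ((6561 / 4096) ^ n * (\<Sum>k<2 ^ n. X n k \<omega> ^ 4))"] by simp
        then have "(6561 / 4096) ^ n * (\<Sum>k<2 ^ n. X n k \<omega> ^ 4) \<le> v ^ 4"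
          unfolding v(2)[symmetric] using v(1) by (subst (asm) ennreal_le_iff) auto
        moreover have "X n k \<omega> ^ 4 \<le> (\<Sum>k<2 ^ n. X n k \<omega> ^ 4)"
          using k by (intro member_le_sum) auto
        ultimately have "(6561 / 4096) ^ n * X n k \<omega> ^ 4 \<le> v ^ 4"
          by (meson mult_left_mono order_trans zero_le_divide_iff zero_le_numeral zero_le_power)
        also have "(6561 / 4096) ^ n * X n k \<omega> ^ 4 = (\<bar>X n k \<omega>\<bar> * (9 / 8) ^ n) ^ 4"
          by (simp add: power_mult_distrib power_mult[symmetric] mult.commute[of n] power_divide)
            (simp add: power_mult)
        finally have "\<bar>X n k \<omega>\<bar> * (9 / 8) ^ n \<le> v"
          using v(1) by (simp add: power_mono_iff)
        then show ?thesis unfolding X_def by (simp add: power_divide field_simps)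
      qed
      have "\<bar>W s \<omega>\<bar> \<le> v / (1 - 8 / 9)" if "s \<in> {0..t}" for s
        using that elim(2)
        by (intro chaining_bound[where w="\<lambda>t. W t \<omega>" and t=t and q="8/9" and v=v] W_start W_continuous t incr) auto
      then show ?case by (auto simp: N_def v_def mult.commute)
    qed
  qed
qed

end

section \<open>The Skorokhod equations along a path\<close>

text \<open>One path of the noise with its regulators. Exchanging the two gaps and changing the sign of
  the noise gives another such path, so that every statement about \<open>A\<close> transfers to \<open>C\<close>.\<close>
locale regulated_path =
  fixes a b g h :: real and w A C :: "real \<Rightarrow> real"
  assumes w_cont: "continuous_on {0..} w"
    and A_cont: "continuous_on {0..} A" and C_cont: "continuous_on {0..} C"
    and A_mono: "mono_on {0..} A" and C_mono: "mono_on {0..} C"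
    and A_0: "A 0 = 0" and C_0: "C 0 = 0"
    and A_eq: "\<And>t. 0 \<le> t \<Longrightarrow> A t = (SUP s\<in>{0..t}. max 0 (- g + a * s + w s + C s / 2))"
    and C_eq: "\<And>t. 0 \<le> t \<Longrightarrow> C t = (SUP s\<in>{0..t}. max 0 (- h + b * s - w s + A s / 2))"
begin

lemma swap: "regulated_path b a h g (\<lambda>t. - w t) C A"
proof
  show "continuous_on {0..} (\<lambda>t. - w t)" by (intro continuous_on_minus w_cont)
  show "C t = (SUP s\<in>{0..t}. max 0 (- h + b * s + - w s + A s / 2))" if "0 \<le> t" for t
    by (subst C_eq[OF that]) simp
  show "A t = (SUP s\<in>{0..t}. max 0 (- g + a * s - - w s + C s / 2))" if "0 \<le> t" for t
    by (subst A_eq[OF that]) simp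
qed (fact A_cont C_cont A_mono C_mono A_0 C_0)+

lemma A_nonneg: "0 \<le> t \<Longrightarrow> 0 \<le> A t"
  using mono_onD[OF A_mono, of 0 t] A_0 by simp

lemma bdd: "bdd_above ((\<lambda>s. max 0 (- g + a * s + w s + C s / 2)) ` {0..t})"
proof -
  have "continuous_on {0..t} (\<lambda>s. max 0 (- g + a * s + w s + C s / 2))"
    by (intro continuous_intros continuous_on_subset[OF w_cont] continuous_on_subset[OF C_cont]) auto
  then show ?thesis
    by (intro bounded_imp_bdd_above compact_imp_bounded compact_continuous_image) auto
qed

lemma A_ge: "0 \<le> s \<Longrightarrow> s \<le> t \<Longrightarrow> - g + a * s + w s + C s / 2 \<le> A t"
  using cSUP_upper[OF _ bdd[of t], of s] A_eq[of t] by simp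

lemma A_le:
  assumes "0 \<le> t" "0 \<le> K" "\<And>s. 0 \<le> s \<Longrightarrow> s \<le> t \<Longrightarrow> - g + a * s + w s + C s / 2 \<le> K"
  shows "A t \<le> K"
proof -
  have "(SUP s\<in>{0..t}. max 0 (- g + a * s + w s + C s / 2)) \<le> K"
    using assms by (intro cSUP_least) auto
  then show ?thesis using A_eq[OF assms(1)] by simp
qed

end

lemma (in regulated_path) C_mono_le: "0 \<le> s \<Longrightarrow> s \<le> t \<Longrightarrow> C s \<le> C t"
  using mono_onD[OF C_mono, of s t] by simp

text \<open>If the gap starts farther from \<open>0\<close> than everything that can drive it down, the
  supremum defining the regulator is \<open>0\<close>; this is the second claim.\<close>
lemma (in regulated_path) A_bound:
  assumes "0 \<le> t" "\<And>s. 0 \<le> s \<Longrightarrow> s \<le> t \<Longrightarrow> \<bar>w s\<bar> \<le> N" "0 \<le> g"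
  shows "A t \<le> \<bar>a\<bar> * t + N + C t / 2"
    and "0 < A t \<Longrightarrow> g \<le> \<bar>a\<bar> * t + N + C t / 2"
proof -
  interpret sw: regulated_path b a h g "\<lambda>t. - w t" C A by (rule swap)
  have "0 \<le> N" using assms(2)[of 0] assms(1) by linarith
  have *: "a * s + w s + C s / 2 \<le> \<bar>a\<bar> * t + N + C t / 2" if "0 \<le> s" "s \<le> t" for s
  proof -
    have "a * s \<le> \<bar>a\<bar> * t" using that by (meson abs_ge_self abs_ge_zero mult_mono order_trans)
    then show ?thesis using assms(2)[OF that] C_mono_le[OF that] by linarith
  qed
  have R0: "0 \<le> \<bar>a\<bar> * t + N + C t / 2"
    using \<open>0 \<le> N\<close> \<open>0 \<le> t\<close> sw.A_nonneg[of t] by simp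
  show "A t \<le> \<bar>a\<bar> * t + N + C t / 2"
  proof (rule A_le[OF assms(1) R0])
    fix s assume "0 \<le> s" "s \<le> t"
    from *[OF this] show "- g + a * s + w s + C s / 2 \<le> \<bar>a\<bar> * t + N + C t / 2" using \<open>0 \<le> g\<close> by linarith
  qed
  show "g \<le> \<bar>a\<bar> * t + N + C t / 2" if "0 < A t"
  proof (rule ccontr)
    assume g: "\<not> ?thesis"
    have "A t \<le> 0"
    proof (rule A_le[OF assms(1)])
      fix s assume "0 \<le> s" "s \<le> t"
      from *[OF this] show "- g + a * s + w s + C s / 2 \<le> 0" using g by linarith
    qed simp
    with that show False by simp
  qed
qed

text \<open>Each regulator feeds only half of itself into the other one, so the sum of the two
  bounds for the single regulators can be solved for \<open>A t + C t\<close>.\<close>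
lemma (in regulated_path) regulator_bounds:
  assumes "0 \<le> t" "\<And>s. 0 \<le> s \<Longrightarrow> s \<le> t \<Longrightarrow> \<bar>w s\<bar> \<le> N" "0 \<le> g" "0 \<le> h"
  shows "A t + C t \<le> 2 * (\<bar>a\<bar> + \<bar>b\<bar>) * t + 4 * N"
    and "0 < A t \<Longrightarrow> g \<le> 2 * (\<bar>a\<bar> + \<bar>b\<bar>) * t + 4 * N"
    and "0 < C t \<Longrightarrow> h \<le> 2 * (\<bar>a\<bar> + \<bar>b\<bar>) * t + 4 * N"
proof -
  interpret sw: regulated_path b a h g "\<lambda>t. - w t" C A by (rule swap)
  have N: "0 \<le> N" using assms(2)[of 0] assms(1) by linarith
  have nn: "0 \<le> \<bar>a\<bar> * t" "0 \<le> \<bar>b\<bar> * t" using assms(1) by auto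
  have "C t \<le> \<bar>b\<bar> * t + N + A t / 2"
    using sw.A_bound(1)[OF assms(1), of N] assms by simp
  moreover have "A t \<le> \<bar>a\<bar> * t + N + C t / 2"
    using A_bound(1)[OF assms(1-3)] .
  ultimately show *: "A t + C t \<le> 2 * (\<bar>a\<bar> + \<bar>b\<bar>) * t + 4 * N" by (simp add: algebra_simps)
  show "g \<le> 2 * (\<bar>a\<bar> + \<bar>b\<bar>) * t + 4 * N" if "0 < A t"
    using A_bound(2)[OF assms(1-3) that] * nn N A_nonneg[OF assms(1)] by (simp add: algebra_simps)
  show "h \<le> 2 * (\<bar>a\<bar> + \<bar>b\<bar>) * t + 4 * N" if "0 < C t"
    using sw.A_bound(2)[OF assms(1), of N, OF _ assms(4) that] assms(2) * nn N sw.A_nonneg[OF assms(1)]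
    by (simp add: algebra_simps)
qed

lemma (in regulated_path) gap_nonneg:
  assumes "0 \<le> t"
  shows "0 \<le> g - a * t - w t - C t / 2 + A t" "0 \<le> h - b * t + w t - A t / 2 + C t"
proof -
  interpret sw: regulated_path b a h g "\<lambda>t. - w t" C A by (rule swap)
  show "0 \<le> g - a * t - w t - C t / 2 + A t" "0 \<le> h - b * t + w t - A t / 2 + C t"
    using A_ge[of t t] sw.A_ge[of t t] assms by auto
qed

lemma regulator_compare:
  assumes p: "regulated_path a b g h w A C" and p': "regulated_path a b g' h' w A' C'"
    and t: "0 \<le> t" and D: "\<And>s. 0 \<le> s \<Longrightarrow> s \<le> t \<Longrightarrow> C s \<le> C' s + D"
    and K: "0 \<le> K" "\<bar>g - g'\<bar> + D / 2 \<le> K"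
  shows "A t \<le> A' t + K"
proof -
  interpret p: regulated_path a b g h w A C by (rule p)
  interpret p': regulated_path a b g' h' w A' C' by (rule p')
  show ?thesis
  proof (rule p.A_le[OF t])
    show "0 \<le> A' t + K" using K p'.A_nonneg[OF t] by simp
    fix s assume s: "0 \<le> s" "s \<le> t"
    show "- g + a * s + w s + C s / 2 \<le> A' t + K"
      using p'.A_ge[OF s] D[OF s] K by linarith
  qed
qed

text \<open>The same factor \<open>1 / 2\<close> makes the system a contraction for the uniform distance on \<open>[0,t]\<close>:
  that distance \<open>D\<close> satisfies \<open>D \<le> d + D / 2\<close>, where \<open>d\<close> is the distance of the initial gaps.
  Lipschitz dependence on the initial gaps is what makes the process jointly measurable.\<close>
lemma regulator_lipschitz:
  assumes p: "regulated_path a b g h w A C" and p': "regulated_path a b g' h' w A' C'" and t: "0 \<le> t"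
  shows "\<bar>A t - A' t\<bar> \<le> 2 * (\<bar>g - g'\<bar> + \<bar>h - h'\<bar>)" "\<bar>C t - C' t\<bar> \<le> 2 * (\<bar>g - g'\<bar> + \<bar>h - h'\<bar>)"
proof -
  interpret p: regulated_path a b g h w A C by (rule p)
  interpret p': regulated_path a b g' h' w A' C' by (rule p')
  define D where "D = (SUP s\<in>{0..t}. max \<bar>A s - A' s\<bar> \<bar>C s - C' s\<bar>)"
  have bdd: "bdd_above ((\<lambda>s. max \<bar>A s - A' s\<bar> \<bar>C s - C' s\<bar>) ` {0..t})"
    by (intro bounded_imp_bdd_above compact_imp_bounded compact_continuous_image continuous_intros
        continuous_on_subset[OF p.A_cont] continuous_on_subset[OF p.C_cont]
        continuous_on_subset[OF p'.A_cont] continuous_on_subset[OF p'.C_cont]) auto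
  have D: "max \<bar>A s - A' s\<bar> \<bar>C s - C' s\<bar> \<le> D" if "0 \<le> s" "s \<le> t" for s
    unfolding D_def using that by (intro cSUP_upper bdd) auto
  have D0: "0 \<le> D" using D[of 0] t by auto
  let ?d = "\<bar>g - g'\<bar> + \<bar>h - h'\<bar>"
  have "max \<bar>A s - A' s\<bar> \<bar>C s - C' s\<bar> \<le> ?d + D / 2" if s: "0 \<le> s" "s \<le> t" for s
  proof -
    have Dr: "A r \<le> A' r + D" "A' r \<le> A r + D" "C r \<le> C' r + D" "C' r \<le> C r + D" if "0 \<le> r" "r \<le> s" for r
      using D[of r] that s by (auto simp: abs_le_iff)
    have "A s \<le> A' s + (?d + D / 2)"
      by (rule regulator_compare[OF p p' s(1) Dr(3)]) (use D0 in auto)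
    moreover have "A' s \<le> A s + (?d + D / 2)"
      by (rule regulator_compare[OF p' p s(1) Dr(4)]) (use D0 in auto)
    moreover have "C s \<le> C' s + (?d + D / 2)"
      by (rule regulator_compare[OF p.swap p'.swap s(1) Dr(1)]) (use D0 in auto)
    moreover have "C' s \<le> C s + (?d + D / 2)"
      by (rule regulator_compare[OF p'.swap p.swap s(1) Dr(2)]) (use D0 in auto)
    ultimately show ?thesis by (auto simp: abs_le_iff)
  qed
  then have "D \<le> ?d + D / 2"
    unfolding D_def using t by (intro cSUP_least) auto
  then show "\<bar>A t - A' t\<bar> \<le> 2 * ?d" "\<bar>C t - C' t\<bar> \<le> 2 * ?d"
    using D[of t] t by auto
qed

section \<open>Expansion over one short step\<close>

lemma exp_minus_taylor:
  fixes z z' :: real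
  assumes "0 \<le> z" "0 \<le> z'"
  shows "\<bar>exp (- z') - exp (- z) * (1 - (z' - z) + (z' - z)\<^sup>2 / 2)\<bar> \<le> \<bar>z' - z\<bar> ^ 3 / 6"
proof (cases "z' = z")
  case False
  define D where "D m t = (- 1) ^ m * exp (- t)" for m :: nat and t :: real
  have "\<exists>t. (if z' < z then z' < t \<and> t < z else z < t \<and> t < z') \<and>
      exp (- z') = (\<Sum>m<3. D m z / fact m * (z' - z) ^ m) + D 3 t / fact 3 * (z' - z) ^ 3"
  proof (rule Taylor[where a = "min z z'" and b = "max z z'"])
    show "\<forall>m t. m < 3 \<and> min z z' \<le> t \<and> t \<le> max z z' \<longrightarrow> (D m has_real_derivative D (Suc m) t) (at t)"
      unfolding D_def by (auto intro!: derivative_eq_intros)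
  qed (use False in \<open>auto simp: D_def\<close>)
  then obtain t where t: "if z' < z then z' < t \<and> t < z else z < t \<and> t < z'"
    and eq: "exp (- z') = (\<Sum>m<3. D m z / fact m * (z' - z) ^ m) + D 3 t / fact 3 * (z' - z) ^ 3"
    by blast
  have "exp (- z') - exp (- z) * (1 - (z' - z) + (z' - z)\<^sup>2 / 2) = - exp (- t) * (z' - z) ^ 3 / 6"
    unfolding eq by (simp add: D_def numeral_3_eq_3 fact_numeral algebra_simps power2_eq_square)
  also have "\<bar>- exp (- t) * (z' - z) ^ 3 / 6\<bar> = exp (- t) * (\<bar>z' - z\<bar> ^ 3 / 6)"
    by (simp add: abs_mult power_abs)
  also have "\<dots> \<le> 1 * (\<bar>z' - z\<bar> ^ 3 / 6)"
    using t assms by (intro mult_right_mono) (auto split: if_splits)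
  finally show ?thesis by simp
qed simp

lemma exp_minus_difference:
  fixes z d :: real
  assumes "0 \<le> z" "0 \<le> d"
  shows "\<bar>exp (- (z + d)) - exp (- z)\<bar> \<le> d"
proof -
  have "exp (- (z + d)) = exp (- z) * exp (- d)" by (simp add: exp_add[symmetric])
  then have "\<bar>exp (- (z + d)) - exp (- z)\<bar> = exp (- z) * (1 - exp (- d))"
    using assms by (simp add: abs_if algebra_simps)
  also have "\<dots> \<le> 1 * d"
    using assms exp_ge_add_one_self[of "- d"] by (intro mult_mono) auto
  finally show ?thesis by simp
qed

text \<open>With time step \<open>t = r ^ 4\<close>, \<open>n\<close> plays the role of the maximum of the noise and \<open>U\<close> that of the
  total push. Since \<open>n ^ 4\<close> has expectation of order \<open>r ^ 8\<close> and \<open>U\<close> of order \<open>r ^ 4\<close>, the right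
  side has expectation of order \<open>r ^ 5\<close>, smaller than \<open>t\<close> by the factor \<open>r\<close>. The product \<open>n * U\<close> is
  split at the level \<open>n = r\<close>, the other terms at \<open>n = r\<^sup>2\<close>.\<close>
lemma moment_interpolation:
  fixes n r U L :: real
  assumes r: "0 < r" "r \<le> 1" and L: "1 \<le> L" and n: "0 \<le> n" and U: "0 \<le> U" "U \<le> L * n"
  shows "n ^ 3 + n * r ^ 4 + n * U \<le> 2 * r ^ 6 + 3 * L * (n ^ 4 / r\<^sup>2) + r * U"
proof -
  have n3: "n ^ 3 \<le> r ^ 6 + n ^ 4 / r\<^sup>2"
  proof (cases "n \<le> r\<^sup>2")
    case True
    then have "n ^ 3 \<le> (r\<^sup>2) ^ 3" using n by (rule power_mono)
    then show ?thesis by (simp add: add_increasing2 flip: power_mult)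
  next
    case False
    then have "n ^ 3 * r\<^sup>2 \<le> n ^ 3 * n" using n by (intro mult_left_mono) auto
    then have "n ^ 3 \<le> n ^ 4 / r\<^sup>2" using r by (simp add: field_simps power4_eq_xxxx power3_eq_cube)
    then show ?thesis by (simp add: add_increasing r(1) less_imp_le)
  qed
  have n1: "n * r ^ 4 \<le> r ^ 6 + n ^ 4 / r\<^sup>2"
  proof (cases "n \<le> r\<^sup>2")
    case True
    then have "n * r ^ 4 \<le> r\<^sup>2 * r ^ 4" using r by (intro mult_right_mono) auto
    then show ?thesis by (simp add: add_increasing2 flip: power_add)
  next
    case False
    then have "(r\<^sup>2)\<^sup>2 \<le> n\<^sup>2" by (intro power_mono) auto
    then have "n * r ^ 4 \<le> n * n\<^sup>2" using n by (intro mult_left_mono) (simp_all flip: power_mult)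
    then show ?thesis using n3 by (simp add: power2_eq_square power3_eq_cube)
  qed
  have n2: "n * U \<le> r * U + L * (n ^ 4 / r\<^sup>2)"
  proof (cases "n \<le> r")
    case True
    then have "n * U \<le> r * U" using U by (intro mult_right_mono) auto
    then show ?thesis using L by (simp add: add_increasing2)
  next
    case False
    have "n * U \<le> n * (L * n)" using n U by (intro mult_left_mono)
    also have "\<dots> \<le> L * (n ^ 4 / r\<^sup>2)"
    proof -
      have "r\<^sup>2 \<le> n\<^sup>2" using False r by (intro power_mono) auto
      then have "n\<^sup>2 * r\<^sup>2 \<le> n\<^sup>2 * n\<^sup>2" by (intro mult_left_mono) auto
      then have "n\<^sup>2 \<le> n ^ 4 / r\<^sup>2" using r by (simp add: field_simps flip: power_add)
      then have "L * n\<^sup>2 \<le> L * (n ^ 4 / r\<^sup>2)" using L by (intro mult_left_mono) auto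
      then show ?thesis by (simp add: power2_eq_square mult.left_commute)
    qed
    finally show ?thesis using r U by (simp add: add_increasing)
  qed
  have "n ^ 4 / r\<^sup>2 \<le> L * (n ^ 4 / r\<^sup>2)" using L mult_right_mono[of 1 L "n ^ 4 / r\<^sup>2"] by simp
  then show ?thesis using n1 n2 n3 by linarith
qed

text \<open>Second-order expansion of \<open>exp (- (x g + y h))\<close> over one step. Besides the Taylor remainder
  the error has two sources: in the quadratic term only the pure noise is kept, and
  in the push terms the weight of the gap that is being pushed is replaced by \<open>1\<close>. The latter
  is harmless because that gap starts near \<open>0\<close> whenever its push is positive.\<close>
lemma step_pointwise:
  fixes a b x y t g h w A C n L m :: real
  defines "g' \<equiv> g - a * t - w - C / 2 + A" and "h' \<equiv> h - b * t + w - A / 2 + C"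
    and "e \<equiv> exp (- (x * g + y * h))"
  assumes xy: "0 \<le> x" "0 \<le> y" and L: "1 \<le> L" and m: "1 \<le> m" "x \<le> m" "y \<le> m" "\<bar>a * x + b * y\<bar> \<le> m"
    and nonneg: "0 \<le> g" "0 \<le> h" "0 \<le> A" "0 \<le> C" "0 \<le> t" "0 \<le> g'" "0 \<le> h'"
    and n: "\<bar>w\<bar> \<le> n" "t \<le> n" "A + C \<le> L * n" "0 < A \<Longrightarrow> g \<le> L * n" "0 < C \<Longrightarrow> h \<le> L * n"
  shows "\<bar>(exp (- (x * g' + y * h')) - e) -
      (e * ((a * x + b * y) * t - (y - x) * w + (y - x)\<^sup>2 / 2 * w\<^sup>2)
        - (x - y / 2) * (exp (- (y * h)) * A) - (y - x / 2) * (exp (- (x * g)) * C))\<bar>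
    \<le> 5 * m ^ 3 * L ^ 3 * (n ^ 3 + n * t + n * (A + C))" (is "\<bar>?T\<bar> \<le> _")
proof -
  define U where "U = A + C"
  define Y where "Y = - ((a * x + b * y) * t) + (x - y / 2) * A + (y - x / 2) * C"
  define d where "d = (y - x) * w + Y"
  have U: "0 \<le> U" "U \<le> L * n" "A \<le> U" "C \<le> U" using nonneg n by (auto simp: U_def)
  have n0: "0 \<le> n" using n nonneg by linarith
  have pq: "\<bar>x - y / 2\<bar> \<le> m" "\<bar>y - x / 2\<bar> \<le> m" "\<bar>y - x\<bar> \<le> m" using xy m by (auto simp: abs_le_iff)
  have e: "0 \<le> e" "e \<le> 1" using xy nonneg by (auto simp: e_def add_nonneg_nonneg simp del: minus_add_distrib)
  have d_eq: "(x * g' + y * h') - (x * g + y * h) = d"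
    by (simp add: g'_def h'_def d_def Y_def algebra_simps)
  have ab_le: "\<bar>u * v\<bar> \<le> m * v" if "\<bar>u\<bar> \<le> m" "0 \<le> v" for u v :: real
    using that by (simp add: abs_mult mult_right_mono)
  have Y: "\<bar>Y\<bar> \<le> m * (t + U)"
  proof -
    have "\<bar>Y\<bar> \<le> \<bar>(a * x + b * y) * t\<bar> + \<bar>(x - y / 2) * A\<bar> + \<bar>(y - x / 2) * C\<bar>"
      unfolding Y_def by (rule order_trans[OF abs_triangle_ineq add_right_mono[OF order_trans[OF abs_triangle_ineq]]]) simp
    also have "\<dots> \<le> m * t + m * A + m * C"
      using m nonneg pq by (intro add_mono ab_le) auto
    finally show ?thesis by (simp add: U_def algebra_simps)
  qed
  have w: "\<bar>(y - x) * w\<bar> \<le> m * n"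
    using pq n n0 m by (simp add: abs_mult mult_mono)
  have Ln: "n \<le> L * n" using L n0 mult_right_mono[of 1 L n] by simp
  have tU: "0 \<le> t + U" "t + U \<le> 2 * (L * n)" using U nonneg n Ln by auto
  have d3: "\<bar>d\<bar> ^ 3 / 6 \<le> 5 * m ^ 3 * L ^ 3 * n ^ 3"
  proof -
    have "\<bar>d\<bar> \<le> m * n + m * (t + U)" using w Y unfolding d_def by linarith
    also have "\<dots> \<le> m * (3 * (L * n))" using tU Ln m unfolding distrib_left[symmetric] by (intro mult_left_mono) auto
    finally have "\<bar>d\<bar> ^ 3 \<le> (3 * (m * (L * n))) ^ 3" by (intro power_mono) auto
    also have "\<dots> = 27 * (m ^ 3 * L ^ 3 * n ^ 3)" by (simp add: power_mult_distrib)
    finally have "\<bar>d\<bar> ^ 3 \<le> 27 * (m ^ 3 * L ^ 3 * n ^ 3)" .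
    moreover have "0 \<le> m ^ 3 * L ^ 3 * n ^ 3" using m L n0 by auto
    ultimately show ?thesis by linarith
  qed
  have mL: "m\<^sup>2 * L \<le> m ^ 3 * L ^ 3"
    using m L by (intro mult_mono power_increasing) (auto intro: self_le_power)
  have p1: "\<bar>exp (- (x * g' + y * h')) - e * (1 - d + d\<^sup>2 / 2)\<bar> \<le> 5 * m ^ 3 * L ^ 3 * n ^ 3"
    using exp_minus_taylor[of "x * g + y * h" "x * g' + y * h'"] d3 xy nonneg unfolding d_eq e_def by auto
  have p2: "\<bar>e * (d\<^sup>2 / 2 - (y - x)\<^sup>2 / 2 * w\<^sup>2)\<bar> \<le> 2 * (m\<^sup>2 * L) * (n * (t + U))"
  proof -
    have "d\<^sup>2 / 2 - (y - x)\<^sup>2 / 2 * w\<^sup>2 = (y - x) * w * Y + Y * Y / 2"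
      unfolding d_def by (simp add: power2_eq_square field_simps)
    moreover have "\<bar>(y - x) * w * Y\<bar> \<le> (m * n) * (m * (t + U))"
      unfolding abs_mult[of _ Y] using w Y m n0 by (intro mult_mono) auto
    then have "\<bar>(y - x) * w * Y\<bar> \<le> m\<^sup>2 * (n * (t + U))"
      by (simp add: power2_eq_square mult_ac)
    moreover have "\<bar>Y * Y\<bar> \<le> (m * (t + U)) * (m * (2 * (L * n)))"
      unfolding abs_mult[of _ Y] using Y tU m n0 L
      by (intro mult_mono order_trans[OF Y]) (auto intro: mult_left_mono)
    then have "\<bar>Y * Y\<bar> \<le> 2 * (m\<^sup>2 * L * (n * (t + U)))"
      by (simp add: power2_eq_square algebra_simps)
    moreover have "\<bar>p + q / 2\<bar> \<le> B + B'" if "\<bar>p\<bar> \<le> B" "\<bar>q\<bar> \<le> 2 * B'" for p q B B' :: real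
      using that by linarith
    ultimately have "\<bar>d\<^sup>2 / 2 - (y - x)\<^sup>2 / 2 * w\<^sup>2\<bar> \<le> m\<^sup>2 * (n * (t + U)) + m\<^sup>2 * L * (n * (t + U))"
      by metis
    moreover have "1 * (m\<^sup>2 * (n * (t + U))) \<le> L * (m\<^sup>2 * (n * (t + U)))"
      using L n0 tU by (intro mult_right_mono) auto
    ultimately have "\<bar>d\<^sup>2 / 2 - (y - x)\<^sup>2 / 2 * w\<^sup>2\<bar> \<le> 2 * (m\<^sup>2 * L) * (n * (t + U))"
      by (simp add: mult_ac)
    then show ?thesis using e unfolding abs_mult
      by (smt (verit) abs_ge_zero mult_left_le_one_le)
  qed
  have p3: "\<bar>(x - y / 2) * ((exp (- (y * h)) - e) * A)\<bar> \<le> m * (m * (L * n) * A)"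
  proof -
    have "\<bar>e - exp (- (y * h))\<bar> * A \<le> m * (L * n) * A"
    proof (cases "A = 0")
      case False
      then have "g \<le> L * n" using n nonneg by auto
      then have "x * g \<le> m * (L * n)" using m nonneg xy by (intro mult_mono) auto
      moreover have "\<bar>e - exp (- (y * h))\<bar> \<le> x * g"
        using exp_minus_difference[of "y * h" "x * g"] xy nonneg unfolding e_def by (simp add: add.commute)
      ultimately show ?thesis using nonneg by (intro mult_right_mono) auto
    qed simp
    then have "\<bar>(exp (- (y * h)) - e) * A\<bar> \<le> m * (L * n) * A"
      using nonneg by (simp add: abs_mult abs_minus_commute)
    then show ?thesis using m unfolding abs_mult[of "x - y / 2"]
      by (intro mult_mono pq(1)) auto
  qed
  have p4: "\<bar>(y - x / 2) * ((exp (- (x * g)) - e) * C)\<bar> \<le> m * (m * (L * n) * C)"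
  proof -
    have "\<bar>e - exp (- (x * g))\<bar> * C \<le> m * (L * n) * C"
    proof (cases "C = 0")
      case False
      then have "h \<le> L * n" using n nonneg by auto
      then have "y * h \<le> m * (L * n)" using m nonneg xy by (intro mult_mono) auto
      moreover have "\<bar>e - exp (- (x * g))\<bar> \<le> y * h"
        using exp_minus_difference[of "x * g" "y * h"] xy nonneg unfolding e_def by (simp add: add.commute)
      ultimately show ?thesis using nonneg by (intro mult_right_mono) auto
    qed simp
    then have "\<bar>(exp (- (x * g)) - e) * C\<bar> \<le> m * (L * n) * C"
      using nonneg by (simp add: abs_mult abs_minus_commute)
    then show ?thesis using m unfolding abs_mult[of "y - x / 2"]
      by (intro mult_mono pq(2)) auto
  qed
  have "?T = (exp (- (x * g' + y * h')) - e * (1 - d + d\<^sup>2 / 2)) + e * (d\<^sup>2 / 2 - (y - x)\<^sup>2 / 2 * w\<^sup>2)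
      + (x - y / 2) * ((exp (- (y * h)) - e) * A) + (y - x / 2) * ((exp (- (x * g)) - e) * C)"
    by (simp add: d_def Y_def algebra_simps)
  moreover have "m * (m * (L * n) * A) + m * (m * (L * n) * C) = (m\<^sup>2 * L) * (n * U)"
    by (simp add: U_def power2_eq_square algebra_simps)
  ultimately have "\<bar>?T\<bar> \<le> 5 * m ^ 3 * L ^ 3 * n ^ 3 + (2 * (m\<^sup>2 * L) * (n * (t + U)) + (m\<^sup>2 * L) * (n * U))"
    using p1 p2 p3 p4 by linarith
  also have "\<dots> \<le> 5 * (m ^ 3 * L ^ 3) * n ^ 3 + 5 * (m ^ 3 * L ^ 3) * (n * t + n * U)"
  proof -
    have "2 * (m\<^sup>2 * L) * (n * (t + U)) + (m\<^sup>2 * L) * (n * U) \<le> 5 * (m\<^sup>2 * L) * (n * t + n * U)"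
      using m L n0 U nonneg by (simp add: algebra_simps)
    also have "\<dots> \<le> 5 * (m ^ 3 * L ^ 3) * (n * t + n * U)"
      using mL n0 U nonneg by (intro mult_right_mono) auto
    finally show ?thesis by (simp add: mult.assoc)
  qed
  also have "\<dots> = 5 * m ^ 3 * L ^ 3 * (n ^ 3 + n * t + n * (A + C))"
    by (simp add: U_def algebra_simps)
  finally show ?thesis .
qed

lemma (in prob_space) integrable_exp_minus:
  fixes f :: "'a \<Rightarrow> real"
  assumes [measurable]: "f \<in> borel_measurable M" and "AE \<omega> in M. 0 \<le> f \<omega>"
  shows "integrable M (\<lambda>\<omega>. exp (- f \<omega>))"
proof (rule integrable_const_bound[where B=1])
  show "AE \<omega> in M. norm (exp (- f \<omega>)) \<le> 1" using assms(2) by eventually_elim simp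
qed simp

text \<open>This is applied with \<open>S = G + H\<close> at time \<open>0\<close>, with \<open>u\<close> half of the total push and with \<open>d\<close> the drift.
  Formally \<open>S - d + u\<close> and \<open>S\<close> have the same law, so \<open>u\<close> has mean \<open>d\<close>; as \<open>S\<close>
  need not be integrable, the mean is approached through the derivative at \<open>0\<close> of the
  Laplace transform.\<close>
lemma (in prob_space) mean_push_le:
  fixes S u :: "'a \<Rightarrow> real"
  assumes S[measurable]: "S \<in> borel_measurable M" and u: "integrable M u"
    and nonneg: "AE \<omega> in M. 0 \<le> S \<omega> \<and> 0 \<le> u \<omega>"
    and inv: "\<And>x. 0 < x \<Longrightarrow> (\<integral>\<omega>. exp (- (x * (S \<omega> - d + u \<omega>))) \<partial>M) = (\<integral>\<omega>. exp (- (x * S \<omega>)) \<partial>M)"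
  shows "(\<integral>\<omega>. u \<omega> \<partial>M) \<le> \<bar>d\<bar>"
proof -
  note [measurable] = borel_measurable_integrable[OF u]
  define x where "x n = 1 / real (Suc n)" for n
  have x: "0 < x n" for n by (simp add: x_def)
  have x0: "x \<longlonglongrightarrow> 0"
    using LIMSEQ_inverse_real_of_nat unfolding x_def inverse_eq_divide .
  let ?f = "\<lambda>n \<omega>. exp (- (x n * S \<omega>)) * ((1 - exp (- (x n * u \<omega>))) / x n)"
  have lim: "(\<lambda>n. \<integral>\<omega>. ?f n \<omega> \<partial>M) \<longlonglongrightarrow> (\<integral>\<omega>. u \<omega> \<partial>M)"
  proof (rule integral_dominated_convergence[where w=u])
    show "AE \<omega> in M. (\<lambda>n. ?f n \<omega>) \<longlonglongrightarrow> u \<omega>"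
    proof (rule AE_I2)
      fix \<omega>
      have "((\<lambda>z. exp (- (z * u \<omega>))) has_real_derivative - u \<omega>) (at 0)"
        by (auto intro!: derivative_eq_intros)
      then have "((\<lambda>z. (exp (- (z * u \<omega>)) - 1) / z) \<longlongrightarrow> - u \<omega>) (at 0)"
        by (simp add: has_field_derivative_iff)
      moreover have "filterlim x (at 0) sequentially"
        using x0 x by (auto simp: filterlim_at less_imp_neq[symmetric])
      ultimately have "(\<lambda>n. (exp (- (x n * u \<omega>)) - 1) / x n) \<longlonglongrightarrow> - u \<omega>"
        by (rule filterlim_compose)
      from tendsto_minus[OF this] have "(\<lambda>n. (1 - exp (- (x n * u \<omega>))) / x n) \<longlonglongrightarrow> u \<omega>"
        by (simp add: diff_divide_distrib)
      moreover have "(\<lambda>n. exp (- (x n * S \<omega>))) \<longlonglongrightarrow> exp (- (0 * S \<omega>))"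
        by (intro tendsto_intros x0)
      ultimately show "(\<lambda>n. ?f n \<omega>) \<longlonglongrightarrow> u \<omega>"
        using tendsto_mult by fastforce
    qed
    show "AE \<omega> in M. norm (?f n \<omega>) \<le> u \<omega>" for n
      using nonneg
    proof eventually_elim
      case (elim \<omega>)
      have "1 - exp (- (x n * u \<omega>)) \<le> x n * u \<omega>" using exp_ge_add_one_self[of "- (x n * u \<omega>)"] by linarith
      then have "(1 - exp (- (x n * u \<omega>))) / x n \<le> u \<omega>" using x[of n] by (simp add: field_simps)
      moreover have "0 \<le> (1 - exp (- (x n * u \<omega>))) / x n" using x[of n] elim by simp
      moreover have "exp (- (x n * S \<omega>)) \<le> 1" using x[of n] elim by simp
      ultimately have "exp (- (x n * S \<omega>)) * ((1 - exp (- (x n * u \<omega>))) / x n) \<le> 1 * u \<omega>"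
        by (intro mult_mono) auto
      then show ?case using elim x[of n] by (simp add: abs_mult)
    qed
  qed (use u in auto)
  moreover have "(\<integral>\<omega>. ?f n \<omega> \<partial>M) \<le> \<bar>d\<bar>" for n
  proof -
    have i1: "integrable M (\<lambda>\<omega>. exp (- (x n * S \<omega>)))"
    proof (rule integrable_exp_minus)
      show "AE \<omega> in M. 0 \<le> x n * S \<omega>" using nonneg by eventually_elim (use x[of n] in auto)
    qed simp
    have i2: "integrable M (\<lambda>\<omega>. exp (- (x n * S \<omega>)) * exp (- (x n * u \<omega>)))"
    proof -
      have "AE \<omega> in M. 0 \<le> x n * S \<omega> + x n * u \<omega>" using nonneg by eventually_elim (use x[of n] in auto)
      then have "integrable M (\<lambda>\<omega>. exp (- (x n * S \<omega> + x n * u \<omega>)))" by (intro integrable_exp_minus) auto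
      then show ?thesis by (simp add: exp_add[symmetric])
    qed
    let ?p = "\<integral>\<omega>. exp (- (x n * S \<omega>)) \<partial>M"
    let ?q = "\<integral>\<omega>. exp (- (x n * S \<omega>)) * exp (- (x n * u \<omega>)) \<partial>M"
    have "(\<lambda>\<omega>. exp (- (x n * (S \<omega> - d + u \<omega>)))) = (\<lambda>\<omega>. exp (x n * d) * (exp (- (x n * S \<omega>)) * exp (- (x n * u \<omega>))))"
      by (simp add: exp_add[symmetric] algebra_simps)
    with inv[OF x[of n]] have pq: "?p = exp (x n * d) * ?q" by simp
    have cancel: "exp (- (x n * d)) * exp (x n * d) = 1" by (simp add: exp_minus)
    have q: "?q = exp (- (x n * d)) * ?p"
      unfolding pq mult.assoc[symmetric] cancel by simp
    have "AE \<omega> in M. exp (- (x n * S \<omega>)) \<le> 1" using nonneg by eventually_elim (use x[of n] in auto)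
    then have p: "0 \<le> ?p" "?p \<le> 1"
      using integral_mono_AE[OF i1, of "\<lambda>_. 1"] by (auto simp: prob_space)
    have "(\<integral>\<omega>. ?f n \<omega> \<partial>M) = (?p - ?q) / x n"
      using i1 i2 by (simp add: right_diff_distrib)
    also have "?p - ?q = (1 - exp (- (x n * d))) * ?p" unfolding q by (simp only: left_diff_distrib mult_1)
    also have "\<dots> \<le> x n * \<bar>d\<bar>"
    proof (cases "0 \<le> 1 - exp (- (x n * d))")
      case True
      have "1 - exp (- (x n * d)) \<le> x n * d" using exp_ge_add_one_self[of "- (x n * d)"] by linarith
      also have "\<dots> \<le> x n * \<bar>d\<bar>" using x[of n] by (intro mult_left_mono) auto
      finally show ?thesis using True p mult_mono[of "1 - exp (- (x n * d))" "x n * \<bar>d\<bar>" ?p 1] x[of n] by simp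
    next
      case False
      then have "(1 - exp (- (x n * d))) * ?p \<le> 0" using p by (intro mult_nonpos_nonneg) auto
      also have "\<dots> \<le> x n * \<bar>d\<bar>" using x[of n] by simp
      finally show ?thesis .
    qed
    finally show ?thesis using x[of n] by (simp add: field_simps divide_right_mono)
  qed
  ultimately show ?thesis by (intro LIMSEQ_le_const2) auto
qed

text \<open>What the expansion uses of a stationary process observed over the time step \<open>r ^ 4\<close>:
  initial gaps \<open>g\<close>, \<open>h\<close>, noise increment \<open>w\<close>, pushes \<open>A\<close>, \<open>C\<close> and a bound \<open>n\<close> for the
  noise. The fourth power avoids fractional exponents of the time step.\<close>
locale stationary_step = prob_space Q for Q :: "'q measure" +
  fixes a b r L :: real and g h w A C n :: "'q \<Rightarrow> real"
  assumes meas[measurable]: "g \<in> borel_measurable Q" "h \<in> borel_measurable Q" "w \<in> borel_measurable Q"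
      "A \<in> borel_measurable Q" "C \<in> borel_measurable Q" "n \<in> borel_measurable Q"
    and r: "0 < r" "r \<le> 1" and L: "1 \<le> L"
    and nonneg: "AE \<omega> in Q. 0 \<le> g \<omega> \<and> 0 \<le> h \<omega> \<and> 0 \<le> A \<omega> \<and> 0 \<le> C \<omega>"
    and gap_nonneg: "AE \<omega> in Q. 0 \<le> g \<omega> - a * r ^ 4 - w \<omega> - C \<omega> / 2 + A \<omega>
      \<and> 0 \<le> h \<omega> - b * r ^ 4 + w \<omega> - A \<omega> / 2 + C \<omega>"
    and bound: "AE \<omega> in Q. \<bar>w \<omega>\<bar> \<le> n \<omega> \<and> r ^ 4 \<le> n \<omega> \<and> A \<omega> + C \<omega> \<le> L * n \<omega>
      \<and> (0 < A \<omega> \<longrightarrow> g \<omega> \<le> L * n \<omega>) \<and> (0 < C \<omega> \<longrightarrow> h \<omega> \<le> L * n \<omega>)"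
    and fourth: "integrable Q (\<lambda>\<omega>. n \<omega> ^ 4)" "(\<integral>\<omega>. n \<omega> ^ 4 \<partial>Q) \<le> L * r ^ 8"
    and push: "(\<integral>\<omega>. A \<omega> + C \<omega> \<partial>Q) \<le> L * r ^ 4"
    and stationary: "\<And>x y. 0 \<le> x \<Longrightarrow> 0 \<le> y \<Longrightarrow>
      (\<integral>\<omega>. exp (- (x * (g \<omega> - a * r ^ 4 - w \<omega> - C \<omega> / 2 + A \<omega>) + y * (h \<omega> - b * r ^ 4 + w \<omega> - A \<omega> / 2 + C \<omega>))) \<partial>Q)
      = (\<integral>\<omega>. exp (- (x * g \<omega> + y * h \<omega>)) \<partial>Q)"
    and noise: "\<And>x y. 0 \<le> x \<Longrightarrow> 0 \<le> y \<Longrightarrow> (\<integral>\<omega>. exp (- (x * g \<omega> + y * h \<omega>)) * w \<omega> \<partial>Q) = 0"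
      "\<And>x y. 0 \<le> x \<Longrightarrow> 0 \<le> y \<Longrightarrow> (\<integral>\<omega>. exp (- (x * g \<omega> + y * h \<omega>)) * (w \<omega>)\<^sup>2 \<partial>Q)
        = r ^ 4 * (\<integral>\<omega>. exp (- (x * g \<omega> + y * h \<omega>)) \<partial>Q)"
begin

lemma integrable_by_fourth:
  assumes [measurable]: "f \<in> borel_measurable Q" and "AE \<omega> in Q. \<bar>f \<omega>\<bar> \<le> K * (1 + n \<omega> ^ 4)"
  shows "integrable Q f"
proof (rule Bochner_Integration.integrable_bound)
  show "integrable Q (\<lambda>\<omega>. K * (1 + n \<omega> ^ 4))" using fourth by simp
  show "AE \<omega> in Q. norm (f \<omega>) \<le> norm (K * (1 + n \<omega> ^ 4))"
    using assms(2) by eventually_elim (auto simp: abs_if)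
qed simp

lemma power_le_fourth: "0 \<le> z \<Longrightarrow> k \<le> 4 \<Longrightarrow> z ^ k \<le> 1 + z ^ 4" for z :: real
proof (cases "z \<le> 1")
  case True
  assume "0 \<le> z" "k \<le> 4"
  then have "z ^ k \<le> 1" using True by (simp add: power_le_one)
  then show ?thesis using \<open>0 \<le> z\<close> by (simp add: add_increasing2)
next
  case False
  assume "0 \<le> z" "k \<le> 4"
  then have "z ^ k \<le> z ^ 4" using False by (intro power_increasing) auto
  then show ?thesis by simp
qed

lemma n_nonneg: "AE \<omega> in Q. 0 \<le> n \<omega>"
  using bound by eventually_elim linarith

lemma integrable_laplace: "0 \<le> x \<Longrightarrow> 0 \<le> y \<Longrightarrow> integrable Q (\<lambda>\<omega>. exp (- (x * g \<omega> + y * h \<omega>)))"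
proof (rule integrable_exp_minus)
  assume "0 \<le> x" "0 \<le> y"
  show "AE \<omega> in Q. 0 \<le> x * g \<omega> + y * h \<omega>"
    using nonneg by eventually_elim (use \<open>0 \<le> x\<close> \<open>0 \<le> y\<close> in auto)
qed measurable

lemma integrable_laplace_mult:
  assumes "0 \<le> x" "0 \<le> y" and f: "f \<in> borel_measurable Q" "AE \<omega> in Q. \<bar>f \<omega>\<bar> \<le> K * (n \<omega>) ^ k" "k \<le> 4" "0 \<le> K"
  shows "integrable Q (\<lambda>\<omega>. exp (- (x * g \<omega> + y * h \<omega>)) * f \<omega>)"
proof (rule integrable_by_fourth)
  show "AE \<omega> in Q. \<bar>exp (- (x * g \<omega> + y * h \<omega>)) * f \<omega>\<bar> \<le> K * (1 + n \<omega> ^ 4)"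
    using nonneg n_nonneg f(2)
  proof eventually_elim
    case (elim \<omega>)
    have "\<bar>exp (- (x * g \<omega> + y * h \<omega>)) * f \<omega>\<bar> \<le> 1 * (K * n \<omega> ^ k)"
      unfolding abs_mult using elim assms(1,2) by (intro mult_mono) (auto simp del: minus_add_distrib)
    also have "\<dots> \<le> K * (1 + n \<omega> ^ 4)"
      using power_le_fourth[of "n \<omega>" k] elim f by (simp add: mult_left_mono)
    finally show ?case .
  qed
qed (use f in measurable)

lemma A_C_bound: "AE \<omega> in Q. \<bar>A \<omega>\<bar> \<le> L * n \<omega> ^ 1" "AE \<omega> in Q. \<bar>C \<omega>\<bar> \<le> L * n \<omega> ^ 1"
  using nonneg bound by (eventually_elim, auto)+

text \<open>The adjoint relation with an explicit error. Stationarity removes the difference of the two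
  exponentials, and independence of \<open>w\<close> from the initial gaps turns the noise terms into a
  multiple of the Laplace transform.\<close>
lemma basic_relation:
  assumes xy: "0 \<le> x" "0 \<le> y"
  defines "m \<equiv> (1 + \<bar>a\<bar> + \<bar>b\<bar>) * (1 + x + y)"
  shows "\<bar>((x - y)\<^sup>2 / 2 + a * x + b * y) * (\<integral>\<omega>. exp (- (x * g \<omega> + y * h \<omega>)) \<partial>Q)
      - (x - y / 2) * ((\<integral>\<omega>. exp (- (y * h \<omega>)) * A \<omega> \<partial>Q) / r ^ 4)
      - (y - x / 2) * ((\<integral>\<omega>. exp (- (x * g \<omega>)) * C \<omega> \<partial>Q) / r ^ 4)\<bar> \<le> (30 * m ^ 3 * L ^ 5) * r"
proof -
  have m: "1 \<le> m" "x \<le> m" "y \<le> m" "\<bar>a * x + b * y\<bar> \<le> m"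
  proof -
    have m_eq: "m = (1 + x + y) + \<bar>a\<bar> * (1 + x + y) + \<bar>b\<bar> * (1 + x + y)" by (simp add: m_def algebra_simps)
    moreover have "0 \<le> \<bar>a\<bar> * (1 + x + y)" "0 \<le> \<bar>b\<bar> * (1 + x + y)" using xy by auto
    ultimately show "1 \<le> m" "x \<le> m" "y \<le> m" using xy by linarith+
    have "\<bar>a * x\<bar> \<le> \<bar>a\<bar> * (1 + x + y)" "\<bar>b * y\<bar> \<le> \<bar>b\<bar> * (1 + x + y)"
      using xy by (auto simp: abs_mult intro!: mult_left_mono)
    then show "\<bar>a * x + b * y\<bar> \<le> m" using m_eq xy by linarith
  qed
  let ?e = "\<lambda>\<omega>. exp (- (x * g \<omega> + y * h \<omega>))"
  let ?e' = "\<lambda>\<omega>. exp (- (x * (g \<omega> - a * r ^ 4 - w \<omega> - C \<omega> / 2 + A \<omega>) + y * (h \<omega> - b * r ^ 4 + w \<omega> - A \<omega> / 2 + C \<omega>)))"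
  let ?\<phi> = "\<integral>\<omega>. ?e \<omega> \<partial>Q"
  let ?I = "\<integral>\<omega>. exp (- (y * h \<omega>)) * A \<omega> \<partial>Q"
  let ?J = "\<integral>\<omega>. exp (- (x * g \<omega>)) * C \<omega> \<partial>Q"
  define T where "T \<omega> = (?e' \<omega> - ?e \<omega>) -
      (?e \<omega> * ((a * x + b * y) * r ^ 4 - (y - x) * w \<omega> + (y - x)\<^sup>2 / 2 * (w \<omega>)\<^sup>2)
        - (x - y / 2) * (exp (- (y * h \<omega>)) * A \<omega>) - (y - x / 2) * (exp (- (x * g \<omega>)) * C \<omega>))" for \<omega>
  have ie: "integrable Q ?e" by (rule integrable_laplace[OF xy])
  have ie': "integrable Q ?e'"
  proof (rule integrable_exp_minus)
    show "AE \<omega> in Q. 0 \<le> x * (g \<omega> - a * r ^ 4 - w \<omega> - C \<omega> / 2 + A \<omega>) + y * (h \<omega> - b * r ^ 4 + w \<omega> - A \<omega> / 2 + C \<omega>)"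
      using gap_nonneg by eventually_elim (use xy in auto)
  qed measurable
  have iw: "integrable Q (\<lambda>\<omega>. ?e \<omega> * w \<omega>)"
    using bound by (intro integrable_laplace_mult[OF xy, of _ 1 1]) (auto elim!: eventually_mono)
  have iw2: "integrable Q (\<lambda>\<omega>. ?e \<omega> * (w \<omega>)\<^sup>2)"
    using bound by (intro integrable_laplace_mult[OF xy, of _ 1 2])
      (auto elim!: eventually_mono simp: abs_le_square_iff[symmetric])
  have iA: "integrable Q (\<lambda>\<omega>. exp (- (y * h \<omega>)) * A \<omega>)"
    using integrable_laplace_mult[of 0 y A L 1] A_C_bound L xy by simp
  have iC: "integrable Q (\<lambda>\<omega>. exp (- (x * g \<omega>)) * C \<omega>)"
    using integrable_laplace_mult[of x 0 C L 1] A_C_bound L xy by simp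
  have iU: "integrable Q (\<lambda>\<omega>. A \<omega> + C \<omega>)"
    using integrable_laplace_mult[of 0 0 A L 1] integrable_laplace_mult[of 0 0 C L 1] A_C_bound L by simp
  have expand: "E' - E - (E * (k * t - p * W + P * W2) - F - G) = E' - E - k * t * E + p * (E * W) - P * (E * W2) + F + G"
    for E' E k t p W P W2 F G :: real
    by (simp add: algebra_simps)
  have "T = (\<lambda>\<omega>. ?e' \<omega> - ?e \<omega> - (a * x + b * y) * r ^ 4 * ?e \<omega> + (y - x) * (?e \<omega> * w \<omega>)
      - (y - x)\<^sup>2 / 2 * (?e \<omega> * (w \<omega>)\<^sup>2) + (x - y / 2) * (exp (- (y * h \<omega>)) * A \<omega>) + (y - x / 2) * (exp (- (x * g \<omega>)) * C \<omega>))"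
    unfolding T_def by (rule ext) (rule expand)
  then have ET: "(\<integral>\<omega>. T \<omega> \<partial>Q) = - (a * x + b * y) * r ^ 4 * ?\<phi> - (y - x)\<^sup>2 / 2 * (r ^ 4 * ?\<phi>) + (x - y / 2) * ?I + (y - x / 2) * ?J"
    and iT: "integrable Q T"
    using ie ie' iw iw2 iA iC by (simp_all add: stationary[OF xy] noise[OF xy] del: minus_add_distrib)
  define c where "c = 5 * m ^ 3 * L ^ 3"
  have c: "0 \<le> c" using m L by (simp add: c_def)
  define B where "B \<omega> = c * (2 * r ^ 6 + 3 * L * (n \<omega> ^ 4 / r\<^sup>2) + r * (A \<omega> + C \<omega>))" for \<omega>
  have T_le: "AE \<omega> in Q. \<bar>T \<omega>\<bar> \<le> B \<omega>"
    using nonneg gap_nonneg bound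
  proof eventually_elim
    case (elim \<omega>)
    have "\<bar>T \<omega>\<bar> \<le> c * (n \<omega> ^ 3 + n \<omega> * r ^ 4 + n \<omega> * (A \<omega> + C \<omega>))"
      unfolding T_def c_def using elim r(1) by (intro step_pointwise xy L m) auto
    also have "\<dots> \<le> B \<omega>"
      unfolding B_def using elim r L c by (intro mult_left_mono moment_interpolation) auto
    finally show ?case .
  qed
  have iB: "integrable Q B" unfolding B_def using fourth iU by (intro integrable_mult_right integrable_add) auto
  have "\<bar>\<integral>\<omega>. T \<omega> \<partial>Q\<bar> \<le> (\<integral>\<omega>. \<bar>T \<omega>\<bar> \<partial>Q)" by (rule integral_abs_bound)
  also have "\<dots> \<le> (\<integral>\<omega>. B \<omega> \<partial>Q)" by (intro integral_mono_AE iB T_le integrable_abs iT)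
  also have "\<dots> = c * (2 * r ^ 6 + 3 * L * ((\<integral>\<omega>. n \<omega> ^ 4 \<partial>Q) / r\<^sup>2) + r * (\<integral>\<omega>. A \<omega> + C \<omega> \<partial>Q))"
    unfolding B_def using fourth iU by (simp add: prob_space)
  also have "\<dots> \<le> c * (6 * L\<^sup>2 * r ^ 5)"
  proof (intro mult_left_mono c)
    have "(\<integral>\<omega>. n \<omega> ^ 4 \<partial>Q) / r\<^sup>2 \<le> L * r ^ 8 / r\<^sup>2" using fourth by (intro divide_right_mono) auto
    also have "\<dots> = L * r ^ 6" using r by (simp add: power_diff[symmetric] flip: times_divide_eq_right)
    finally have "3 * L * ((\<integral>\<omega>. n \<omega> ^ 4 \<partial>Q) / r\<^sup>2) \<le> 3 * L * (L * r ^ 6)" using L by (intro mult_left_mono) auto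
    also have "\<dots> \<le> 3 * L\<^sup>2 * r ^ 5"
      using r L power_decreasing[of 5 6 r] by (simp add: power2_eq_square mult.assoc mult_left_mono)
    finally have 1: "3 * L * ((\<integral>\<omega>. n \<omega> ^ 4 \<partial>Q) / r\<^sup>2) \<le> 3 * (L\<^sup>2 * r ^ 5)" by simp
    have L2: "1 \<le> L\<^sup>2" "L \<le> L\<^sup>2" using L by (auto simp: self_le_power)
    have "r * (\<integral>\<omega>. A \<omega> + C \<omega> \<partial>Q) \<le> r * (L * r ^ 4)" using push r by (intro mult_left_mono) auto
    also have "\<dots> = L * r ^ 5" by (simp add: power_Suc[symmetric] del: power_Suc)
    also have "\<dots> \<le> L\<^sup>2 * r ^ 5" using L2 r by (intro mult_right_mono) auto
    finally have 2: "r * (\<integral>\<omega>. A \<omega> + C \<omega> \<partial>Q) \<le> L\<^sup>2 * r ^ 5" .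
    have "1 * r ^ 6 \<le> L\<^sup>2 * r ^ 5" using r L2 by (intro mult_mono power_decreasing) auto
    then show "2 * r ^ 6 + 3 * L * ((\<integral>\<omega>. n \<omega> ^ 4 \<partial>Q) / r\<^sup>2) + r * (\<integral>\<omega>. A \<omega> + C \<omega> \<partial>Q) \<le> 6 * L\<^sup>2 * r ^ 5"
      using 1 2 by linarith
  qed
  also have "\<dots> = (30 * m ^ 3 * L ^ 5) * r * r ^ 4"
    by (simp add: c_def power_add[of L 3 2, simplified] power_Suc[of r 4, simplified])
  finally have "\<bar>\<integral>\<omega>. T \<omega> \<partial>Q\<bar> \<le> (30 * m ^ 3 * L ^ 5) * r * r ^ 4" .
  moreover have "(\<integral>\<omega>. T \<omega> \<partial>Q) = - (r ^ 4) * (((x - y)\<^sup>2 / 2 + a * x + b * y) * ?\<phi> - (x - y / 2) * (?I / r ^ 4) - (y - x / 2) * (?J / r ^ 4))"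
    unfolding ET using r by (simp add: field_simps power2_commute[of y x])
  ultimately show ?thesis using r by (simp add: abs_mult mult.commute[of _ "r ^ 4"])
qed

end

section \<open>Solutions of product form\<close>

lemma quadratic_coefficients_zero:
  fixes c0 c1 c2 :: real
  assumes "\<And>x. 0 < x \<Longrightarrow> c0 + c1 * x + c2 * x\<^sup>2 = 0"
  shows "c0 = 0 \<and> c1 = 0 \<and> c2 = 0"
  using assms[of 1] assms[of 2] assms[of 3] by simp

text \<open>Dividing the relation by \<open>y\<close> and letting \<open>y\<close> tend to infinity leaves only the limit \<open>v\<^sub>0\<close> of
  \<open>y * v y\<close>, the value at \<open>0\<close> of the density of the second factor. That this limit exists follows
  from the relation itself at any \<open>x\<close> with \<open>u x \<noteq> 1\<close>; non-negativity of the boundary transform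
  provides such an \<open>x\<close>. The conclusion says that \<open>u\<close> is the transform of an exponential law.\<close>
lemma exponential_transform:
  fixes u v F G :: "real \<Rightarrow> real"
  assumes kernel: "\<And>x y. 0 < x \<Longrightarrow> 0 < y \<Longrightarrow>
      ((x - y)\<^sup>2 / 2 + a * x + b * y) * (u x * v y) = (x - y / 2) * F y + (y - x / 2) * G x"
    and F: "\<And>y. 0 < y \<Longrightarrow> F y = 2 * \<gamma> - (y + 2 * b) * v y"
    and G: "\<And>x. 0 < x \<Longrightarrow> G x = 2 * \<alpha> - (x + 2 * a) * u x"
    and G_nonneg: "\<And>x. 0 < x \<Longrightarrow> 0 \<le> G x"
  obtains v\<^sub>0 where "((\<lambda>y. y * v y) \<longlongrightarrow> v\<^sub>0) at_top"
    and "\<And>x. 0 < x \<Longrightarrow> u x * (x + (v\<^sub>0 / 2 + 2 * a)) = v\<^sub>0 / 2 + 2 * \<alpha> - \<gamma>"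
proof -
  let ?B = "\<lambda>x y. (x / y - 1)\<^sup>2 / 2 * u x + (a * (x / y) * (1 / y) + b * (1 / y)) * u x + (x / y - 1 / 2) * (1 + 2 * b * (1 / y))"
  let ?R = "\<lambda>x y. 2 * \<gamma> * (x / y - 1 / 2) + (1 - x / 2 * (1 / y)) * G x"
  have inv0: "((\<lambda>y. c * (1 / y)) \<longlongrightarrow> 0) at_top" for c :: real
    by (rule tendsto_mult_right_zero) (simp add: tendsto_inverse_0_at_top filterlim_ident divide_inverse)
  have div0: "((\<lambda>y. c / y) \<longlongrightarrow> 0) at_top" for c :: real
    using inv0[of c] by simp
  have B: "(?B x \<longlongrightarrow> (u x - 1) / 2) at_top" for x
    by (rule tendsto_eq_intros inv0 div0 refl | simp add: field_simps)+
  have R: "(?R x \<longlongrightarrow> G x - \<gamma>) at_top" for x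
    by (rule tendsto_eq_intros inv0 div0 refl | simp add: field_simps)+
  have eq: "y * v y * ?B x y = ?R x y" if "0 < x" "0 < y" for x y
  proof -
    have "y * (y * v y * ?B x y) = ((x - y)\<^sup>2 / 2 + a * x + b * y) * (u x * v y) + (x - y / 2) * (y + 2 * b) * v y"
      using that by (simp add: field_simps power2_eq_square)
    also have "\<dots> = y * ?R x y"
      unfolding kernel[OF that] F[OF that(2)] using that by (simp add: field_simps)
    finally show ?thesis using that by simp
  qed
  \<comment> \<open>large enough that \<open>u x1 = 1\<close> would make the boundary transform negative\<close>
  define x1 where "x1 = max 1 (1 + 2 * \<alpha> - 2 * a)"
  have "0 < x1" "x1 + 2 * a > 2 * \<alpha>" by (auto simp: x1_def max_def)
  then have u1: "u x1 \<noteq> 1" using G[of x1] G_nonneg[of x1] by auto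
  define v0 where "v0 = (G x1 - \<gamma>) / ((u x1 - 1) / 2)"
  have "((\<lambda>y. ?R x1 y / ?B x1 y) \<longlongrightarrow> v0) at_top"
    unfolding v0_def using u1 by (intro tendsto_divide B R) auto
  moreover have "\<forall>\<^sub>F y in at_top. ?B x1 y \<noteq> 0"
    using tendsto_imp_eventually_ne[OF B[of x1]] u1 by auto
  then have "\<forall>\<^sub>F y in at_top. ?R x1 y / ?B x1 y = y * v y"
    using eventually_gt_at_top[of 0]
  proof eventually_elim
    case (elim y)
    then show ?case using eq[of x1 y] \<open>0 < x1\<close> by (metis nonzero_mult_div_cancel_right)
  qed
  ultimately have v0: "((\<lambda>y. y * v y) \<longlongrightarrow> v0) at_top"
    by (rule Lim_transform_eventually)
  have "u x * (x + (v0 / 2 + 2 * a)) = v0 / 2 + 2 * \<alpha> - \<gamma>" if "0 < x" for x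
  proof -
    have "((\<lambda>y. y * v y * ?B x y) \<longlongrightarrow> v0 * ((u x - 1) / 2)) at_top"
      by (intro tendsto_mult v0 B)
    moreover have "\<forall>\<^sub>F y in at_top. y * v y * ?B x y = ?R x y"
      using eventually_gt_at_top[of 0] by eventually_elim (rule eq[OF that])
    ultimately have "(?R x \<longlongrightarrow> v0 * ((u x - 1) / 2)) at_top"
      by (rule Lim_transform_eventually)
    then have "v0 * ((u x - 1) / 2) = G x - \<gamma>"
      using tendsto_unique[OF _ _ R[of x]] by simp
    then show ?thesis using G[OF that] by (simp add: field_simps)
  qed
  with v0 show thesis by (rule that)
qed

lemma exponential_limit:
  fixes u :: "real \<Rightarrow> real"
  assumes u: "\<And>x. 0 < x \<Longrightarrow> u x * (x + l) = c" and pos: "\<And>x. 0 < x \<Longrightarrow> 0 < u x"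
  shows "((\<lambda>x. x * u x) \<longlongrightarrow> c) at_top" "0 < c"
proof -
  have x1: "0 < max 1 (1 - l)" "0 < max 1 (1 - l) + l" by (auto simp: max_def)
  show "0 < c" using u[OF x1(1)] pos[OF x1(1)] x1(2) by (metis mult_pos_pos)
  have *: "((\<lambda>x. inverse (1 + l * inverse x) * c) \<longlongrightarrow> inverse (1 + l * 0) * c) at_top"
    by (intro tendsto_intros tendsto_inverse_0_at_top filterlim_ident) auto
  have "\<forall>\<^sub>F x in at_top. inverse (1 + l * inverse x) * c = x * u x"
    using eventually_gt_at_top[of "max 0 (- l)"]
  proof eventually_elim
    case (elim x)
    then have "0 < x" "0 < x + l" by auto
    then show ?case using u[of x] by (simp add: field_simps)
  qed
  from Lim_transform_eventually[OF * this] show "((\<lambda>x. x * u x) \<longlongrightarrow> c) at_top" by simp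
qed

text \<open>With \<open>u x = u0 / (x + l)\<close> and \<open>v y = v0 / (y + m)\<close> the relation becomes a polynomial identity.
  Its coefficients of \<open>x\<^sup>2 * y\<close> and \<open>x * y\<^sup>2\<close> give \<open>u0 = 2 * \<alpha>\<close> and \<open>v0 = 2 * \<gamma>\<close>, after which the
  coefficient of \<open>x * y\<close> forces \<open>u0 * v0 = 0\<close>, whereas both factors are positive.\<close>
lemma no_product_solution:
  fixes u v F G :: "real \<Rightarrow> real"
  assumes kernel: "\<And>x y. 0 < x \<Longrightarrow> 0 < y \<Longrightarrow>
      ((x - y)\<^sup>2 / 2 + a * x + b * y) * (u x * v y) = (x - y / 2) * F y + (y - x / 2) * G x"
    and F: "\<And>y. 0 < y \<Longrightarrow> F y = 2 * \<gamma> - (y + 2 * b) * v y"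
    and G: "\<And>x. 0 < x \<Longrightarrow> G x = 2 * \<alpha> - (x + 2 * a) * u x"
    and nonneg: "\<And>x. 0 < x \<Longrightarrow> 0 \<le> F x" "\<And>x. 0 < x \<Longrightarrow> 0 \<le> G x"
    and pos: "\<And>x. 0 < x \<Longrightarrow> 0 < u x" "\<And>x. 0 < x \<Longrightarrow> 0 < v x"
  shows False
proof -
  obtain v0 where v0: "((\<lambda>y. y * v y) \<longlongrightarrow> v0) at_top"
    and u: "\<And>x. 0 < x \<Longrightarrow> u x * (x + (v0 / 2 + 2 * a)) = v0 / 2 + 2 * \<alpha> - \<gamma>"
    using exponential_transform[OF kernel F G nonneg(2)] by blast
  have kernel': "((y - x)\<^sup>2 / 2 + b * y + a * x) * (v y * u x) = (y - x / 2) * G x + (x - y / 2) * F y"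
    if "0 < y" "0 < x" for x y
    using kernel[OF that(2,1)] by (simp add: power2_commute algebra_simps)
  obtain u0 where u0: "((\<lambda>x. x * u x) \<longlongrightarrow> u0) at_top"
    and v: "\<And>y. 0 < y \<Longrightarrow> v y * (y + (u0 / 2 + 2 * b)) = u0 / 2 + 2 * \<gamma> - \<alpha>"
    using exponential_transform[OF kernel' G F nonneg(1)] by blast
  define l where "l = v0 / 2 + 2 * a"
  define m where "m = u0 / 2 + 2 * b"
  have u0_eq: "u0 = v0 / 2 + 2 * \<alpha> - \<gamma>" and u0_pos: "0 < u0"
    using exponential_limit[OF u pos(1)] tendsto_unique[OF _ u0] by auto
  have v0_eq: "v0 = u0 / 2 + 2 * \<gamma> - \<alpha>" and v0_pos: "0 < v0"
    using exponential_limit[OF v pos(2)] tendsto_unique[OF _ v0] by auto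
  have ul: "u x * (x + l) = u0" if "0 < x" for x using u[OF that] u0_eq by (simp add: l_def)
  have vm: "v y * (y + m) = v0" if "0 < y" for y using v[OF that] v0_eq by (simp add: m_def)
  have poly: "((x - y)\<^sup>2 / 2 + a * x + b * y) * u0 * v0 =
      (x - y / 2) * (x + l) * (2 * \<gamma> * (y + m) - (y + 2 * b) * v0)
      + (y - x / 2) * (y + m) * (2 * \<alpha> * (x + l) - (x + 2 * a) * u0)" if "0 < x" "0 < y" for x y
  proof -
    have "((x - y)\<^sup>2 / 2 + a * x + b * y) * u0 * v0
        = ((x - y)\<^sup>2 / 2 + a * x + b * y) * (u x * v y) * ((x + l) * (y + m))"
      unfolding ul[OF that(1), symmetric] vm[OF that(2), symmetric] by (simp add: mult_ac)
    also have "\<dots> = ((x - y / 2) * (x + l)) * (F y * (y + m)) + ((y - x / 2) * (y + m)) * (G x * (x + l))"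
      unfolding kernel[OF that] by (simp add: algebra_simps add_divide_distrib)
    also have "F y * (y + m) = 2 * \<gamma> * (y + m) - (y + 2 * b) * v0"
      unfolding F[OF that(2)] vm[OF that(2), symmetric] by (simp add: algebra_simps)
    also have "G x * (x + l) = 2 * \<alpha> * (x + l) - (x + 2 * a) * u0"
      unfolding G[OF that(1)] ul[OF that(1), symmetric] by (simp add: algebra_simps)
    finally show ?thesis .
  qed
  define P where "P = 2 * \<gamma> - v0"
  define Q where "Q = 2 * \<gamma> * m - 2 * b * v0"
  define R where "R = 2 * \<alpha> - u0"
  define S where "S = 2 * \<alpha> * l - 2 * a * u0"
  define U where "U = u0 * v0"
  \<comment> \<open>coefficients of \<open>1\<close>, \<open>x\<close>, \<open>x\<^sup>2\<close> for fixed \<open>y\<close>, which are themselves polynomials in \<open>y\<close>\<close>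
  have rows: "(b * y * U + y\<^sup>2 / 2 * U + y / 2 * l * (P * y + Q) - y * (y + m) * S) = 0
      \<and> (a * U - y * U - (l - y / 2) * (P * y + Q) - (y + m) * (R * y - S / 2)) = 0
      \<and> (U / 2 - (P * y + Q) + (y + m) * R / 2) = 0" if "0 < y" for y
  proof (rule quadratic_coefficients_zero)
    fix x :: real assume "0 < x"
    from poly[OF this that]
    show "(b * y * U + y\<^sup>2 / 2 * U + y / 2 * l * (P * y + Q) - y * (y + m) * S)
      + (a * U - y * U - (l - y / 2) * (P * y + Q) - (y + m) * (R * y - S / 2)) * x
      + (U / 2 - (P * y + Q) + (y + m) * R / 2) * x\<^sup>2 = 0"
      unfolding P_def Q_def R_def S_def U_def by (simp add: field_simps power2_eq_square)
  qed
  have "(a * U - l * Q + m * S / 2) + (Q / 2 - U - l * P - m * R + S / 2) * y + (P / 2 - R) * y\<^sup>2 = 0" if "0 < y" for y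
    using rows[OF that] by (simp add: field_simps power2_eq_square)
  from quadratic_coefficients_zero[OF this]
  have c1: "Q / 2 - U - l * P - m * R + S / 2 = 0" "P / 2 - R = 0" by auto
  have "(U / 2 - Q + m * R / 2) + (R / 2 - P) * y + 0 * y\<^sup>2 = 0" if "0 < y" for y
    using rows[OF that] by (simp add: field_simps power2_eq_square)
  from quadratic_coefficients_zero[OF this]
  have c2: "U / 2 - Q + m * R / 2 = 0" "R / 2 - P = 0" by auto
  from c1 c2 have "P = 0" "R = 0" by auto
  then have \<gamma>: "v0 = 2 * \<gamma>" and \<alpha>: "u0 = 2 * \<alpha>" by (auto simp: P_def R_def)
  have "Q = U / 2" using c2 \<open>R = 0\<close> by simp
  moreover have "S = U / 2"
    unfolding S_def l_def U_def \<gamma> \<alpha> by (simp add: field_simps)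
  moreover have "0 < U" using u0_pos v0_pos by (simp add: U_def)
  ultimately show False using c1 \<open>P = 0\<close> \<open>R = 0\<close> by simp
qed

text \<open>Passage from the approximate relation to the exact one. The limits of \<open>F\<close> and \<open>G\<close> are not
  assumed: on the lines \<open>x = 2 * y\<close> and \<open>y = 2 * x\<close> one of the two boundary terms drops out, which
  shows that the other one converges. The values \<open>\<alpha>\<close>, \<open>\<gamma>\<close> at \<open>0\<close> are then read off on the axes.\<close>
lemma no_product_limit:
  fixes u v :: "real \<Rightarrow> real" and F G :: "real \<Rightarrow> real \<Rightarrow> real"
  assumes lim: "\<And>x y. 0 \<le> x \<Longrightarrow> 0 \<le> y \<Longrightarrow>
      ((\<lambda>r. (x - y / 2) * F r y + (y - x / 2) * G r x) \<longlongrightarrow> ((x - y)\<^sup>2 / 2 + a * x + b * y) * (u x * v y)) (at_right 0)"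
    and nonneg: "\<And>r x. 0 < r \<Longrightarrow> 0 \<le> x \<Longrightarrow> 0 \<le> F r x" "\<And>r x. 0 < r \<Longrightarrow> 0 \<le> x \<Longrightarrow> 0 \<le> G r x"
    and pos: "\<And>x. 0 \<le> x \<Longrightarrow> 0 < u x" "\<And>x. 0 \<le> x \<Longrightarrow> 0 < v x"
    and one: "u 0 = 1" "v 0 = 1"
  shows False
proof -
  have ev0: "\<forall>\<^sub>F r in at_right (0::real). 0 < r" by (rule eventually_at_right_less)
  have F_lim: "\<exists>l. ((\<lambda>r. F r y) \<longlongrightarrow> l) (at_right 0)" if y: "0 < y" for y
  proof -
    have "((\<lambda>r. (3 / 2 * y) * F r y / (3 / 2 * y)) \<longlongrightarrow> ((2 * y - y)\<^sup>2 / 2 + a * (2 * y) + b * y) * (u (2 * y) * v y) / (3 / 2 * y)) (at_right 0)"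
      using lim[of "2 * y" y] y by (intro tendsto_divide tendsto_const) auto
    then show ?thesis using y by auto
  qed
  have G_lim: "\<exists>l. ((\<lambda>r. G r x) \<longlongrightarrow> l) (at_right 0)" if x: "0 < x" for x
  proof -
    have "((\<lambda>r. (3 / 2 * x) * G r x / (3 / 2 * x)) \<longlongrightarrow> ((x - 2 * x)\<^sup>2 / 2 + a * x + b * (2 * x)) * (u x * v (2 * x)) / (3 / 2 * x)) (at_right 0)"
      using lim[of x "2 * x"] x by (intro tendsto_divide tendsto_const) auto
    then show ?thesis using x by auto
  qed
  define Fl where "Fl y = Lim (at_right 0) (\<lambda>r. F r y)" for y
  define Gl where "Gl x = Lim (at_right 0) (\<lambda>r. G r x)" for x
  have Fl: "((\<lambda>r. F r y) \<longlongrightarrow> Fl y) (at_right 0)" if "0 < y" for y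
    using F_lim[OF that] unfolding Fl_def by (auto simp: tendsto_Lim)
  have Gl: "((\<lambda>r. G r x) \<longlongrightarrow> Gl x) (at_right 0)" if "0 < x" for x
    using G_lim[OF that] unfolding Gl_def by (auto simp: tendsto_Lim)
  have F0: "((\<lambda>r. F r 0) \<longlongrightarrow> (x / 2 + a) * u x + Gl x / 2) (at_right 0)" if x: "0 < x" for x
  proof -
    have "((\<lambda>r. (((x - 0 / 2) * F r 0 + (0 - x / 2) * G r x) + x / 2 * G r x) / x)
        \<longlongrightarrow> (((x - 0)\<^sup>2 / 2 + a * x + b * 0) * (u x * v 0) + x / 2 * Gl x) / x) (at_right 0)"
      using x by (intro tendsto_divide tendsto_add lim tendsto_mult Gl tendsto_const) auto
    moreover have "(((x - 0 / 2) * F r 0 + (0 - x / 2) * G r x) + x / 2 * G r x) / x = F r 0" for r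
      using x by simp
    moreover have "(((x - 0)\<^sup>2 / 2 + a * x + b * 0) * (u x * v 0) + x / 2 * Gl x) / x = (x / 2 + a) * u x + Gl x / 2"
      using x by (simp add: one power2_eq_square add_divide_distrib distrib_right)
    ultimately show ?thesis by (simp only:)
  qed
  have G0: "((\<lambda>r. G r 0) \<longlongrightarrow> (y / 2 + b) * v y + Fl y / 2) (at_right 0)" if y: "0 < y" for y
  proof -
    have "((\<lambda>r. (((0 - y / 2) * F r y + (y - 0 / 2) * G r 0) + y / 2 * F r y) / y)
        \<longlongrightarrow> (((0 - y)\<^sup>2 / 2 + a * 0 + b * y) * (u 0 * v y) + y / 2 * Fl y) / y) (at_right 0)"
      using y by (intro tendsto_divide tendsto_add lim tendsto_mult Fl tendsto_const) auto
    moreover have "(((0 - y / 2) * F r y + (y - 0 / 2) * G r 0) + y / 2 * F r y) / y = G r 0" for r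
      using y by simp
    moreover have "(((0 - y)\<^sup>2 / 2 + a * 0 + b * y) * (u 0 * v y) + y / 2 * Fl y) / y = (y / 2 + b) * v y + Fl y / 2"
      using y by (simp add: one power2_eq_square add_divide_distrib distrib_right)
    ultimately show ?thesis by (simp only:)
  qed
  define \<alpha> where "\<alpha> = (1 / 2 + a) * u 1 + Gl 1 / 2"
  define \<gamma> where "\<gamma> = (1 / 2 + b) * v 1 + Fl 1 / 2"
  show False
  proof (rule no_product_solution[where u=u and v=v and F=Fl and G=Gl and a=a and b=b and \<alpha>=\<alpha> and \<gamma>=\<gamma>])
    fix x :: real assume x: "0 < x"
    have "\<alpha> = (x / 2 + a) * u x + Gl x / 2"
      unfolding \<alpha>_def using tendsto_unique[OF _ F0[of 1] F0[OF x]] by simp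
    then show "Gl x = 2 * \<alpha> - (x + 2 * a) * u x" by (simp add: field_simps)
    have "\<gamma> = (x / 2 + b) * v x + Fl x / 2"
      unfolding \<gamma>_def using tendsto_unique[OF _ G0[of 1] G0[OF x]] by simp
    then show "Fl x = 2 * \<gamma> - (x + 2 * b) * v x" by (simp add: field_simps)
    show "0 \<le> Fl x"
      by (rule tendsto_lowerbound[OF Fl[OF x]]) (use ev0 x in \<open>auto elim!: eventually_mono intro: nonneg\<close>)
    show "0 \<le> Gl x"
      by (rule tendsto_lowerbound[OF Gl[OF x]]) (use ev0 x in \<open>auto elim!: eventually_mono intro: nonneg\<close>)
    show "0 < u x" "0 < v x" using pos x by auto
    fix y :: real assume y: "0 < y"
    have "((\<lambda>r. (x - y / 2) * F r y + (y - x / 2) * G r x) \<longlongrightarrow> (x - y / 2) * Fl y + (y - x / 2) * Gl x) (at_right 0)"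
      using x y by (intro tendsto_intros Fl Gl)
    then show "((x - y)\<^sup>2 / 2 + a * x + b * y) * (u x * v y) = (x - y / 2) * Fl y + (y - x / 2) * Gl x"
      using tendsto_unique[OF _ lim[of x y]] x y by simp
  qed
qed

section \<open>The stationary process on a product space\<close>

lemma (in pair_sigma_finite) integral_pair_times:
  fixes f :: "'a \<Rightarrow> real" and k :: "'b \<Rightarrow> real"
  assumes f: "integrable M1 f" and k: "integrable M2 k"
  shows "integrable (M1 \<Otimes>\<^sub>M M2) (\<lambda>z. f (fst z) * k (snd z))"
    and "(\<integral>z. f (fst z) * k (snd z) \<partial>(M1 \<Otimes>\<^sub>M M2)) = (\<integral>x. f x \<partial>M1) * (\<integral>y. k y \<partial>M2)"
proof -
  note [measurable] = borel_measurable_integrable[OF f] borel_measurable_integrable[OF k]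
  show *: "integrable (M1 \<Otimes>\<^sub>M M2) (\<lambda>z. f (fst z) * k (snd z))"
    by (rule Fubini_integrable) (auto simp: abs_mult f k)
  from integral_fst'[OF *]
  show "(\<integral>z. f (fst z) * k (snd z) \<partial>(M1 \<Otimes>\<^sub>M M2)) = (\<integral>x. f x \<partial>M1) * (\<integral>y. k y \<partial>M2)" by simp
qed

lemma (in pair_sigma_finite) AE_pair_snd:
  assumes "AE y in M2. P y"
  shows "AE z in M1 \<Otimes>\<^sub>M M2. P (snd z)"
proof -
  obtain N where N: "{y \<in> space M2. \<not> P y} \<subseteq> N" "N \<in> null_sets M2"
    using assms by (auto elim!: AE_E intro: null_setsI)
  have "emeasure (M1 \<Otimes>\<^sub>M M2) (space M1 \<times> N) = 0"
    using N(2) by (simp add: M2.emeasure_pair_measure_Times null_setsD1 null_setsD2)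
  then have "space M1 \<times> N \<in> null_sets (M1 \<Otimes>\<^sub>M M2)"
    using N(2) by (intro null_setsI) auto
  then show ?thesis
    by (rule AE_I') (use N(1) in \<open>auto simp: space_pair_measure\<close>)
qed

text \<open>A function that is measurable in one variable and continuous in the other is the limit of
  its values at the nearest lower grid points, of which there are countably many.\<close>
lemma borel_measurable_caratheodory:
  fixes F :: "real \<times> real \<Rightarrow> 'a \<Rightarrow> real"
  assumes F: "\<And>z. F z \<in> borel_measurable M"
    and cont: "\<And>\<omega>. \<omega> \<in> space M \<Longrightarrow> continuous_on UNIV (\<lambda>z. F z \<omega>)"
  shows "(\<lambda>p. F (fst p) (snd p)) \<in> borel_measurable (borel \<Otimes>\<^sub>M M)"
proof -
  define q :: "nat \<Rightarrow> int \<times> int \<Rightarrow> real \<times> real" where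
    "q n k = (of_int (fst k) / real (Suc n), of_int (snd k) / real (Suc n))" for n k
  define c :: "nat \<Rightarrow> real \<times> real \<Rightarrow> int \<times> int" where
    "c n z = (\<lfloor>real (Suc n) * fst z\<rfloor>, \<lfloor>real (Suc n) * snd z\<rfloor>)" for n z
  have floor_lim: "(\<lambda>n. of_int \<lfloor>real (Suc n) * s\<rfloor> / real (Suc n)) \<longlonglongrightarrow> s" for s :: real
  proof (rule real_tendsto_sandwich)
    have "(\<lambda>n. s - inverse (real (Suc n))) \<longlonglongrightarrow> s - 0"
      by (intro tendsto_diff tendsto_const LIMSEQ_inverse_real_of_nat)
    then show "(\<lambda>n. s - inverse (real (Suc n))) \<longlonglongrightarrow> s" by simp
    show "\<forall>\<^sub>F n in sequentially. s - inverse (real (Suc n)) \<le> of_int \<lfloor>real (Suc n) * s\<rfloor> / real (Suc n)"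
    proof (rule always_eventually, rule allI)
      fix n
      have "real (Suc n) * s - 1 \<le> of_int \<lfloor>real (Suc n) * s\<rfloor>" by linarith
      then have "(real (Suc n) * s - 1) / real (Suc n) \<le> of_int \<lfloor>real (Suc n) * s\<rfloor> / real (Suc n)"
        by (rule divide_right_mono) simp
      then show "s - inverse (real (Suc n)) \<le> of_int \<lfloor>real (Suc n) * s\<rfloor> / real (Suc n)"
        by (simp add: diff_divide_distrib inverse_eq_divide)
    qed
    show "\<forall>\<^sub>F n in sequentially. of_int \<lfloor>real (Suc n) * s\<rfloor> / real (Suc n) \<le> s"
    proof (rule always_eventually, rule allI)
      fix n
      have "of_int \<lfloor>real (Suc n) * s\<rfloor> \<le> real (Suc n) * s" by linarith
      then show "of_int \<lfloor>real (Suc n) * s\<rfloor> / real (Suc n) \<le> s" by (simp add: divide_le_eq mult.commute)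
    qed
  qed simp
  show ?thesis
  proof (rule borel_measurable_LIMSEQ_real)
    fix n
    have c[measurable]: "(\<lambda>p. c n (fst p)) \<in> measurable (borel \<Otimes>\<^sub>M M) (count_space UNIV)"
      unfolding c_def borel_prod[symmetric] by measurable
    show "(\<lambda>p. F (q n (c n (fst p))) (snd p)) \<in> borel_measurable (borel \<Otimes>\<^sub>M M)"
      by (rule measurable_compose_countable[OF _ c, where f="\<lambda>k p. F (q n k) (snd p)"])
        (rule measurable_compose[OF measurable_snd F])
  next
    fix p :: "(real \<times> real) \<times> 'a" assume "p \<in> space (borel \<Otimes>\<^sub>M M)"
    then have p: "snd p \<in> space M" by (auto simp: space_pair_measure)
    have "(\<lambda>n. q n (c n (fst p))) \<longlonglongrightarrow> (fst (fst p), snd (fst p))"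
      unfolding q_def c_def by (intro tendsto_Pair) (simp_all only: fst_conv snd_conv floor_lim)
    then show "(\<lambda>n. F (q n (c n (fst p))) (snd p)) \<longlonglongrightarrow> F (fst p) (snd p)"
      using continuous_on_tendsto_compose[OF cont[OF p], of "\<lambda>n. q n (c n (fst p))" "fst p" sequentially] by simp
  qed
qed

lemma lipschitz_continuous_pair:
  fixes F :: "real \<times> real \<Rightarrow> real"
  assumes "\<And>z z'. \<bar>F z - F z'\<bar> \<le> K * (\<bar>fst z - fst z'\<bar> + \<bar>snd z - snd z'\<bar>)" and K: "0 \<le> K"
  shows "continuous_on UNIV F"
proof -
  have "\<bar>F z - F z'\<bar> \<le> (2 * K) * dist z z'" for z z'
  proof -
    have "\<bar>fst z - fst z'\<bar> + \<bar>snd z - snd z'\<bar> \<le> 2 * dist z z'"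
      using dist_fst_le[of z z'] dist_snd_le[of z z'] by (simp add: dist_real_def)
    then have "K * (\<bar>fst z - fst z'\<bar> + \<bar>snd z - snd z'\<bar>) \<le> K * (2 * dist z z')" using K by (rule mult_left_mono)
    then show ?thesis using assms(1)[of z z'] by simp
  qed
  then have "(2 * K)-lipschitz_on UNIV F" using K by (auto simp: lipschitz_on_def dist_real_def)
  then show ?thesis by (rule lipschitz_on_continuous_on)
qed

lemma (in standard_brownian_motion) natural_filtration_measurable:
  assumes f: "f \<in> borel_measurable (natural_filtration M W t)"
  shows "f \<in> borel_measurable M"
proof -
  have "id \<in> measurable M (natural_filtration M W t)"
    unfolding natural_filtration_def
  proof (rule measurable_measure_of)
    fix y assume "y \<in> {W s -` B \<inter> space M |s B. s \<in> {0..t} \<and> B \<in> sets borel}"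
    then obtain s B where y: "y = W s -` B \<inter> space M" "0 \<le> s" "B \<in> sets borel" by auto
    have "y \<in> sets M" unfolding y(1) by (rule measurable_sets[OF W_measurable[OF y(2)] y(3)])
    then show "id -` y \<inter> space M \<in> sets M" by (auto simp: y)
  qed auto
  from measurable_comp[OF this f] show ?thesis by simp
qed

locale stationary_gaps = standard_brownian_motion M W for M :: "'a measure" and W +
  fixes \<delta>\<^sub>1 \<delta>\<^sub>2 \<delta>\<^sub>3 :: real and A \<Gamma> :: "real \<Rightarrow> real \<Rightarrow> real \<Rightarrow> 'a \<Rightarrow> real" and \<pi> :: "(real \<times> real) measure"
  assumes regulators: "\<And>g h. 0 \<le> g \<Longrightarrow> 0 \<le> h \<Longrightarrow>
           collision_local_times M W \<delta>\<^sub>1 \<delta>\<^sub>2 \<delta>\<^sub>3 g h (A g h) (\<Gamma> g h)"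
    and invariant: "invariant_gap_distribution M W \<delta>\<^sub>1 \<delta>\<^sub>2 \<delta>\<^sub>3 A \<Gamma> \<pi>"
begin

abbreviation a where "a \<equiv> \<delta>\<^sub>2 - \<delta>\<^sub>1"
abbreviation b where "b \<equiv> \<delta>\<^sub>3 - \<delta>\<^sub>2"

lemma regulated: "0 \<le> g \<Longrightarrow> 0 \<le> h \<Longrightarrow> \<omega> \<in> space M \<Longrightarrow>
    regulated_path a b g h (\<lambda>t. W t \<omega>) (\<lambda>t. A g h t \<omega>) (\<lambda>t. \<Gamma> g h t \<omega>)"
  using regulators[of g h] W_continuous[of \<omega>]
  unfolding collision_local_times_def continuous_increasing_adapted_def regulated_path_def by blast

lemma regulator_measurable:
  assumes "0 \<le> g" "0 \<le> h" "0 \<le> t"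
  shows "A g h t \<in> borel_measurable M" "\<Gamma> g h t \<in> borel_measurable M"
  using regulators[OF assms(1,2)] assms(3)
  unfolding collision_local_times_def continuous_increasing_adapted_def
  by (auto intro!: natural_filtration_measurable[of _ t])

sublocale \<pi>: prob_space \<pi>
  using invariant by (simp add: invariant_gap_distribution_def)

lemma sets_\<pi>[measurable_cong]: "sets \<pi> = sets borel"
  using invariant by (simp add: invariant_gap_distribution_def)

lemma space_\<pi>: "space \<pi> = UNIV"
  using sets_eq_imp_space_eq[OF sets_\<pi>] by simp

lemma AE_quadrant: "AE z in \<pi>. 0 \<le> fst z \<and> 0 \<le> snd z"
proof -
  have "emeasure \<pi> quadrant = 1" using invariant by (simp add: invariant_gap_distribution_def)
  then have "AE z in \<pi>. z \<in> quadrant" by (intro \<pi>.AE_prob_1) (simp add: measure_def)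
  then show ?thesis by eventually_elim auto
qed

sublocale Q: pair_prob_space \<pi> M ..

abbreviation Q where "Q \<equiv> \<pi> \<Otimes>\<^sub>M M"

text \<open>On \<open>Q\<close> the initial gaps are the first coordinate and the Brownian path is a function of the
  second. Truncation at \<open>0\<close> changes nothing almost surely and makes the regulators, which
  are only controlled for non-negative gaps, continuous on the whole plane.\<close>
definition G\<^sub>0 :: "(real \<times> real) \<times> 'a \<Rightarrow> real" where "G\<^sub>0 p = max 0 (fst (fst p))"
definition H\<^sub>0 :: "(real \<times> real) \<times> 'a \<Rightarrow> real" where "H\<^sub>0 p = max 0 (snd (fst p))"
definition noise :: "real \<Rightarrow> (real \<times> real) \<times> 'a \<Rightarrow> real" where "noise t p = W t (snd p)"
definition left_push :: "real \<Rightarrow> (real \<times> real) \<times> 'a \<Rightarrow> real" where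
  "left_push t p = A (G\<^sub>0 p) (H\<^sub>0 p) t (snd p)"
definition right_push :: "real \<Rightarrow> (real \<times> real) \<times> 'a \<Rightarrow> real" where
  "right_push t p = \<Gamma> (G\<^sub>0 p) (H\<^sub>0 p) t (snd p)"
definition gap :: "real \<Rightarrow> (real \<times> real) \<times> 'a \<Rightarrow> real \<times> real" where
  "gap t p = (G\<^sub>0 p - a * t - noise t p - right_push t p / 2 + left_push t p,
              H\<^sub>0 p - b * t + noise t p - left_push t p / 2 + right_push t p)"

lemma start_nonneg: "0 \<le> G\<^sub>0 p" "0 \<le> H\<^sub>0 p"
  by (auto simp: G\<^sub>0_def H\<^sub>0_def)

lemma start_measurable[measurable]: "G\<^sub>0 \<in> borel_measurable Q" "H\<^sub>0 \<in> borel_measurable Q"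
proof -
  have "(\<lambda>z. max 0 (fst z)) \<in> borel_measurable (borel :: (real \<times> real) measure)"
    "(\<lambda>z. max 0 (snd z)) \<in> borel_measurable (borel :: (real \<times> real) measure)"
    by (intro borel_measurable_continuous_onI continuous_intros)+
  then have m: "(\<lambda>z. max 0 (fst z)) \<in> borel_measurable \<pi>" "(\<lambda>z. max 0 (snd z)) \<in> borel_measurable \<pi>"
    by (simp_all add: measurable_cong_sets[OF sets_\<pi> refl])
  show "G\<^sub>0 \<in> borel_measurable Q" "H\<^sub>0 \<in> borel_measurable Q"
    unfolding G\<^sub>0_def H\<^sub>0_def
    by (rule measurable_compose[OF measurable_fst m(1)], rule measurable_compose[OF measurable_fst m(2)])
qed

lemma noise_measurable: "0 \<le> t \<Longrightarrow> noise t \<in> borel_measurable Q"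
  unfolding noise_def by (rule measurable_compose[OF measurable_snd W_measurable])

lemma push_measurable:
  assumes t: "0 \<le> t"
  shows "left_push t \<in> borel_measurable Q" "right_push t \<in> borel_measurable Q"
proof -
  have cont: "continuous_on UNIV (\<lambda>z. A (max 0 (fst z)) (max 0 (snd z)) t \<omega>)"
    "continuous_on UNIV (\<lambda>z. \<Gamma> (max 0 (fst z)) (max 0 (snd z)) t \<omega>)" if "\<omega> \<in> space M" for \<omega>
  proof -
    have clamp: "2 * (\<bar>max 0 (fst z) - max 0 (fst z')\<bar> + \<bar>max 0 (snd z) - max 0 (snd z')\<bar>)
        \<le> 2 * (\<bar>fst z - fst z'\<bar> + \<bar>snd z - snd z'\<bar>)" for z z' :: "real \<times> real"
      by (intro mult_left_mono add_mono) (auto simp: max_def)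
    have reg: "regulated_path a b (max 0 (fst z)) (max 0 (snd z)) (\<lambda>t. W t \<omega>)
      (\<lambda>t. A (max 0 (fst z)) (max 0 (snd z)) t \<omega>) (\<lambda>t. \<Gamma> (max 0 (fst z)) (max 0 (snd z)) t \<omega>)" for z :: "real \<times> real"
      using that by (intro regulated) auto
    show "continuous_on UNIV (\<lambda>z. A (max 0 (fst z)) (max 0 (snd z)) t \<omega>)"
      by (rule lipschitz_continuous_pair[where K=2])
        (rule order_trans[OF regulator_lipschitz(1)[OF reg reg t] clamp], simp)
    show "continuous_on UNIV (\<lambda>z. \<Gamma> (max 0 (fst z)) (max 0 (snd z)) t \<omega>)"
      by (rule lipschitz_continuous_pair[where K=2])
        (rule order_trans[OF regulator_lipschitz(2)[OF reg reg t] clamp], simp)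
  qed
  have "sets (borel \<Otimes>\<^sub>M M) = sets Q" by (intro sets_pair_measure_cong) (simp_all add: sets_\<pi>)
  then have *: "borel_measurable (borel \<Otimes>\<^sub>M M) = borel_measurable Q" by (intro measurable_cong_sets) auto
  show "left_push t \<in> borel_measurable Q"
    unfolding left_push_def G\<^sub>0_def H\<^sub>0_def *[symmetric]
    by (rule borel_measurable_caratheodory[where F="\<lambda>z. A (max 0 (fst z)) (max 0 (snd z)) t"])
      (auto intro!: regulator_measurable t cont)
  show "right_push t \<in> borel_measurable Q"
    unfolding right_push_def G\<^sub>0_def H\<^sub>0_def *[symmetric]
    by (rule borel_measurable_caratheodory[where F="\<lambda>z. \<Gamma> (max 0 (fst z)) (max 0 (snd z)) t"])
      (auto intro!: regulator_measurable t cont)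
qed

lemma gap_measurable: "0 \<le> t \<Longrightarrow> gap t \<in> borel_measurable Q"
  unfolding gap_def borel_prod[symmetric]
  using noise_measurable[of t] push_measurable[of t] by measurable

text \<open>Invariance, which is stated with transition probabilities, becomes a statement about one
  random variable on the product space.\<close>
lemma distr_gap:
  assumes t: "0 \<le> t"
  shows "distr Q borel (gap t) = \<pi>"
proof (rule measure_eqI)
  show "sets (distr Q borel (gap t)) = sets \<pi>" by (simp add: sets_\<pi>)
  fix B assume "B \<in> sets (distr Q borel (gap t))"
  then have B: "B \<in> sets borel" by simp
  note gap_measurable[OF t, measurable]
  let ?X = "gap t -` B \<inter> space Q"
  have X: "?X \<in> sets Q" using B by measurable
  have "emeasure (distr Q borel (gap t)) B = (\<integral>\<^sup>+z. emeasure M (Pair z -` ?X) \<partial>\<pi>)"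
    using B X by (simp add: emeasure_distr emeasure_pair_measure_alt)
  also have "\<dots> = (\<integral>\<^sup>+z\<in>quadrant. emeasure M {\<omega> \<in> space M.
       gap_process W \<delta>\<^sub>1 \<delta>\<^sub>2 \<delta>\<^sub>3 (fst z) (snd z) (A (fst z) (snd z)) (\<Gamma> (fst z) (snd z)) t \<omega> \<in> B} \<partial>\<pi>)"
  proof (rule nn_integral_cong_AE)
    show "AE z in \<pi>. emeasure M (Pair z -` ?X) = emeasure M {\<omega> \<in> space M.
       gap_process W \<delta>\<^sub>1 \<delta>\<^sub>2 \<delta>\<^sub>3 (fst z) (snd z) (A (fst z) (snd z)) (\<Gamma> (fst z) (snd z)) t \<omega> \<in> B} * indicator quadrant z"
      using AE_quadrant
    proof eventually_elim
      case (elim z)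
      then have "Pair z -` ?X = {\<omega> \<in> space M.
         gap_process W \<delta>\<^sub>1 \<delta>\<^sub>2 \<delta>\<^sub>3 (fst z) (snd z) (A (fst z) (snd z)) (\<Gamma> (fst z) (snd z)) t \<omega> \<in> B}"
        by (auto simp: gap_def gap_process_def G\<^sub>0_def H\<^sub>0_def left_push_def right_push_def noise_def
            space_pair_measure space_\<pi>)
      moreover have "z \<in> quadrant" using elim by (auto simp: mem_Times_iff)
      ultimately show ?case by simp
    qed
  qed
  also have "\<dots> = emeasure \<pi> B"
    using invariant B t by (simp add: invariant_gap_distribution_def)
  finally show "emeasure (distr Q borel (gap t)) B = emeasure \<pi> B" .
qed

lemma expectation_gap:
  fixes f :: "real \<times> real \<Rightarrow> real"
  assumes f: "f \<in> borel_measurable borel" and t: "0 \<le> t"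
  shows "(\<integral>p. f (gap t p) \<partial>Q) = (\<integral>z. f z \<partial>\<pi>)"
  using integral_distr[OF gap_measurable[OF t] f] distr_gap[OF t] by simp

text \<open>The gap process at time \<open>0\<close> is its initial value, so this is invariance at time \<open>0\<close>.\<close>
lemma expectation_start:
  fixes f :: "real \<times> real \<Rightarrow> real"
  assumes f: "f \<in> borel_measurable borel"
  shows "(\<integral>p. f (G\<^sub>0 p, H\<^sub>0 p) \<partial>Q) = (\<integral>z. f z \<partial>\<pi>)"
proof -
  have "gap 0 p = (G\<^sub>0 p, H\<^sub>0 p)" if "p \<in> space Q" for p
  proof -
    have p: "snd p \<in> space M" using that by (auto simp: space_pair_measure)
    from regulated[OF start_nonneg this, of p p] W_start[OF p]
    show ?thesis by (simp add: gap_def noise_def left_push_def right_push_def regulated_path_def)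
  qed
  then have "(\<integral>p. f (G\<^sub>0 p, H\<^sub>0 p) \<partial>Q) = (\<integral>p. f (gap 0 p) \<partial>Q)"
    by (intro Bochner_Integration.integral_cong) auto
  then show ?thesis using expectation_gap[OF f, of 0] by simp
qed

lemma expectation_stationary:
  fixes f :: "real \<times> real \<Rightarrow> real"
  assumes "f \<in> borel_measurable borel" "0 \<le> t"
  shows "(\<integral>p. f (gap t p) \<partial>Q) = (\<integral>p. f (G\<^sub>0 p, H\<^sub>0 p) \<partial>Q)"
  using expectation_gap[OF assms] expectation_start[OF assms(1)] by simp

text \<open>One constant for all bounds: \<open>8 * (100000 + 1) \<le> 900000\<close> bounds the fourth moment of the
  noise, \<open>4\<close> and the remaining summand come from the regulators.\<close>
definition L :: real where "L = 900004 + 2 * (\<bar>a\<bar> + \<bar>b\<bar>)"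

lemma path_bounds:
  assumes t: "0 \<le> t" and p: "p \<in> space Q" and N: "\<forall>s\<in>{0..t}. \<bar>W s (snd p)\<bar> \<le> N"
  shows "0 \<le> left_push t p" "0 \<le> right_push t p"
    and "0 \<le> G\<^sub>0 p - a * t - noise t p - right_push t p / 2 + left_push t p"
    and "0 \<le> H\<^sub>0 p - b * t + noise t p - left_push t p / 2 + right_push t p"
    and "left_push t p + right_push t p \<le> L * (N + t)"
    and "0 < left_push t p \<Longrightarrow> G\<^sub>0 p \<le> L * (N + t)" "0 < right_push t p \<Longrightarrow> H\<^sub>0 p \<le> L * (N + t)"
proof -
  have "snd p \<in> space M" using p by (auto simp: space_pair_measure)
  then interpret path: regulated_path a b "G\<^sub>0 p" "H\<^sub>0 p" "\<lambda>t. W t (snd p)" "\<lambda>t. left_push t p" "\<lambda>t. right_push t p"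
    unfolding left_push_def right_push_def by (intro regulated start_nonneg)
  have N': "\<bar>W s (snd p)\<bar> \<le> N" if "0 \<le> s" "s \<le> t" for s using N that by simp
  have "0 \<le> N" using N'[of 0] t by linarith
  then have L: "2 * (\<bar>a\<bar> + \<bar>b\<bar>) * t + 4 * N \<le> L * (N + t)"
  proof -
    have "4 * N \<le> L * N" "2 * (\<bar>a\<bar> + \<bar>b\<bar>) * t \<le> L * t"
      using \<open>0 \<le> N\<close> t by (auto simp: L_def intro!: mult_right_mono)
    then show ?thesis by (simp add: distrib_left)
  qed
  show "0 \<le> left_push t p" by (rule path.A_nonneg[OF t])
  show "0 \<le> right_push t p" using path.swap t by (rule regulated_path.A_nonneg)
  show "0 \<le> G\<^sub>0 p - a * t - noise t p - right_push t p / 2 + left_push t p"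
    and "0 \<le> H\<^sub>0 p - b * t + noise t p - left_push t p / 2 + right_push t p"
    using path.gap_nonneg[OF t] by (auto simp: noise_def)
  show "left_push t p + right_push t p \<le> L * (N + t)"
    using path.regulator_bounds(1)[OF t N' start_nonneg] L by linarith
  show "0 < left_push t p \<Longrightarrow> G\<^sub>0 p \<le> L * (N + t)" "0 < right_push t p \<Longrightarrow> H\<^sub>0 p \<le> L * (N + t)"
    using path.regulator_bounds(2,3)[OF t N' start_nonneg] L by linarith+
qed

lemma laplace_integrable:
  assumes "0 \<le> x" "0 \<le> y"
  shows "integrable \<pi> (\<lambda>z. exp (- (x * max 0 (fst z) + y * max 0 (snd z))))"
proof (rule \<pi>.integrable_exp_minus)
  have "(\<lambda>z. x * max 0 (fst z) + y * max 0 (snd z)) \<in> borel_measurable (borel :: (real \<times> real) measure)"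
    by (intro borel_measurable_continuous_onI continuous_intros)
  then show "(\<lambda>z. x * max 0 (fst z) + y * max 0 (snd z)) \<in> borel_measurable \<pi>"
    by (simp add: measurable_cong_sets[OF sets_\<pi> refl])
qed (use assms in auto)

lemma laplace_noise:
  assumes xy: "0 \<le> x" "0 \<le> y" and t: "0 < t"
  shows "(\<integral>p. exp (- (x * G\<^sub>0 p + y * H\<^sub>0 p)) \<partial>Q) = (\<integral>z. exp (- (x * max 0 (fst z) + y * max 0 (snd z))) \<partial>\<pi>)"
    and "(\<integral>p. exp (- (x * G\<^sub>0 p + y * H\<^sub>0 p)) * noise t p \<partial>Q) = 0"
    and "(\<integral>p. exp (- (x * G\<^sub>0 p + y * H\<^sub>0 p)) * (noise t p)\<^sup>2 \<partial>Q) = t * (\<integral>p. exp (- (x * G\<^sub>0 p + y * H\<^sub>0 p)) \<partial>Q)"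
proof -
  let ?f = "\<lambda>z. exp (- (x * max 0 (fst z) + y * max 0 (snd z)))"
  have W0: "W t \<omega> = W t \<omega> - W 0 \<omega>" if "\<omega> \<in> space M" for \<omega> using W_start[OF that] by simp
  have i1: "integrable M (W t)" and e1: "(\<integral>\<omega>. W t \<omega> \<partial>M) = 0"
    using increment_moments(5,6)[of 0 t] t W0
    by (simp_all cong: Bochner_Integration.integrable_cong Bochner_Integration.integral_cong)
  have i2: "integrable M (\<lambda>\<omega>. (W t \<omega>)\<^sup>2)" and e2: "(\<integral>\<omega>. (W t \<omega>)\<^sup>2 \<partial>M) = t"
    using increment_moments(3,4)[of 0 t] t W0
    by (simp_all cong: Bochner_Integration.integrable_cong Bochner_Integration.integral_cong)
  show e: "(\<integral>p. exp (- (x * G\<^sub>0 p + y * H\<^sub>0 p)) \<partial>Q) = (\<integral>z. ?f z \<partial>\<pi>)"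
    using Q.integral_pair_times(2)[OF laplace_integrable[OF xy], of "\<lambda>_. 1"]
    by (simp add: G\<^sub>0_def H\<^sub>0_def prob_space)
  show "(\<integral>p. exp (- (x * G\<^sub>0 p + y * H\<^sub>0 p)) * noise t p \<partial>Q) = 0"
    using Q.integral_pair_times(2)[OF laplace_integrable[OF xy] i1] e1
    by (simp add: G\<^sub>0_def H\<^sub>0_def noise_def)
  show "(\<integral>p. exp (- (x * G\<^sub>0 p + y * H\<^sub>0 p)) * (noise t p)\<^sup>2 \<partial>Q) = t * (\<integral>p. exp (- (x * G\<^sub>0 p + y * H\<^sub>0 p)) \<partial>Q)"
    unfolding e using Q.integral_pair_times(2)[OF laplace_integrable[OF xy] i2] e2
    by (simp add: G\<^sub>0_def H\<^sub>0_def noise_def)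
qed

text \<open>All requirements of the expansion hold with constants that do not depend on \<open>r\<close>.\<close>
lemma stationary_step_at:
  assumes r: "0 < r" "r \<le> 1"
  obtains n where "stationary_step Q a b r L G\<^sub>0 H\<^sub>0 (noise (r ^ 4)) (left_push (r ^ 4)) (right_push (r ^ 4)) n"
proof -
  let ?t = "r ^ 4"
  have t: "0 < ?t" "0 \<le> ?t" "?t \<le> 1" using r by (auto intro: power_le_one)
  note [measurable] = noise_measurable[OF t(2)] push_measurable[OF t(2)]
  obtain N where N: "N \<in> borel_measurable M" "\<And>\<omega>. 0 \<le> N \<omega>"
    "AE \<omega> in M. \<forall>s\<in>{0..?t}. \<bar>W s \<omega>\<bar> \<le> N \<omega>"
    "integrable M (\<lambda>\<omega>. N \<omega> ^ 4)" "(\<integral>\<omega>. N \<omega> ^ 4 \<partial>M) \<le> 100000 * ?t\<^sup>2"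
    using maximal_bound[OF t(1)] by blast
  define n where "n p = N (snd p) + ?t" for p :: "(real \<times> real) \<times> 'a"
  have n[measurable]: "n \<in> borel_measurable Q"
    unfolding n_def using measurable_compose[OF measurable_snd N(1)] by measurable
  have N4: "integrable Q (\<lambda>p. N (snd p) ^ 4)" "(\<integral>p. N (snd p) ^ 4 \<partial>Q) \<le> 100000 * r ^ 8"
    using Q.integral_pair_times[OF _ N(4), of "\<lambda>_. 1"] N(5) by (simp_all add: \<pi>.prob_space flip: power_mult)
  have n4_le: "n p ^ 4 \<le> 8 * N (snd p) ^ 4 + 8 * r ^ 16" for p
  proof -
    have sq: "(c + d)\<^sup>2 \<le> 2 * (c\<^sup>2 + d\<^sup>2)" for c d :: real
      using zero_le_power2[of "c - d"] by (simp add: power2_eq_square algebra_simps)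
    have "n p ^ 4 = ((n p)\<^sup>2)\<^sup>2" by simp
    also have "\<dots> \<le> (2 * ((N (snd p))\<^sup>2 + ?t\<^sup>2))\<^sup>2" unfolding n_def by (intro power_mono sq) auto
    also have "\<dots> = 4 * ((N (snd p))\<^sup>2 + ?t\<^sup>2)\<^sup>2" by (simp only: power_mult_distrib) simp
    also have "\<dots> \<le> 4 * (2 * (((N (snd p))\<^sup>2)\<^sup>2 + (?t\<^sup>2)\<^sup>2))" by (intro mult_left_mono sq) auto
    also have "\<dots> = 8 * N (snd p) ^ 4 + 8 * r ^ 16"
      by (simp only: power_mult[symmetric]) simp
    finally show ?thesis .
  qed
  have n_nonneg: "0 \<le> n p" for p unfolding n_def using N(2) t by simp
  have i4: "integrable Q (\<lambda>p. n p ^ 4)"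
  proof (rule Bochner_Integration.integrable_bound)
    show "integrable Q (\<lambda>p. 8 * N (snd p) ^ 4 + 8 * r ^ 16)" using N4 by simp
    show "AE p in Q. norm (n p ^ 4) \<le> norm (8 * N (snd p) ^ 4 + 8 * r ^ 16)"
      using n4_le n_nonneg r by (intro AE_I2) (auto intro: order_trans[OF _ abs_ge_self])
  qed simp
  have "(\<integral>p. n p ^ 4 \<partial>Q) \<le> (\<integral>p. 8 * N (snd p) ^ 4 + 8 * r ^ 16 \<partial>Q)"
    using i4 N4 n4_le by (intro integral_mono) auto
  also have "\<dots> \<le> 900000 * r ^ 8"
  proof -
    have "r ^ 16 \<le> r ^ 8" "0 \<le> r ^ 8" using r by (auto intro: power_decreasing)
    moreover have "(\<integral>p. 8 * N (snd p) ^ 4 + 8 * r ^ 16 \<partial>Q) = 8 * (\<integral>p. N (snd p) ^ 4 \<partial>Q) + 8 * r ^ 16"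
      using N4 Q.P.prob_space by simp
    ultimately show ?thesis using N4(2) by linarith
  qed
  also have "\<dots> \<le> L * r ^ 8" using r by (intro mult_right_mono) (auto simp: L_def)
  finally have E4: "(\<integral>p. n p ^ 4 \<partial>Q) \<le> L * r ^ 8" .
  have paths: "AE p in Q. p \<in> space Q \<and> (\<forall>s\<in>{0..?t}. \<bar>W s (snd p)\<bar> \<le> N (snd p))"
    using Q.AE_pair_snd[OF N(3)] AE_space by eventually_elim simp
  have U_le: "AE p in Q. 0 \<le> left_push ?t p \<and> 0 \<le> right_push ?t p \<and> left_push ?t p + right_push ?t p \<le> L * n p"
    using paths by eventually_elim (auto simp: n_def intro: path_bounds[OF t(2)])
  have n1: "n p \<le> 1 + n p ^ 4" for p
  proof (cases "n p \<le> 1")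
    case False
    then show ?thesis using self_le_power[of "n p" 4] by simp
  qed (use n_nonneg[of p] in \<open>simp add: add_increasing2\<close>)
  have iU: "integrable Q (\<lambda>p. left_push ?t p + right_push ?t p)"
  proof (rule Bochner_Integration.integrable_bound)
    show "integrable Q (\<lambda>p. L * (1 + n p ^ 4))" using i4 by simp
    show "AE p in Q. norm (left_push ?t p + right_push ?t p) \<le> norm (L * (1 + n p ^ 4))"
      using U_le
    proof eventually_elim
      case (elim p)
      have "L * n p \<le> L * (1 + n p ^ 4)" by (intro mult_left_mono n1) (simp add: L_def)
      then show ?case using elim by simp
    qed
  qed simp
  have stat: "(\<integral>p. exp (- (x * (G\<^sub>0 p - a * ?t - noise ?t p - right_push ?t p / 2 + left_push ?t p)
        + y * (H\<^sub>0 p - b * ?t + noise ?t p - left_push ?t p / 2 + right_push ?t p))) \<partial>Q)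
      = (\<integral>p. exp (- (x * G\<^sub>0 p + y * H\<^sub>0 p)) \<partial>Q)" for x y
  proof -
    have "(\<lambda>z. exp (- (x * fst z + y * snd z))) \<in> borel_measurable (borel :: (real \<times> real) measure)"
      by (intro borel_measurable_continuous_onI continuous_intros)
    from expectation_stationary[OF this t(2)] show ?thesis by (simp add: gap_def)
  qed
  have "(\<integral>p. (left_push ?t p + right_push ?t p) / 2 \<partial>Q) \<le> \<bar>(a + b) * ?t\<bar>"
  proof (rule Q.P.mean_push_le)
    show "(\<lambda>p. G\<^sub>0 p + H\<^sub>0 p) \<in> borel_measurable Q" by measurable
    show "integrable Q (\<lambda>p. (left_push ?t p + right_push ?t p) / 2)" using iU by simp
    show "AE p in Q. 0 \<le> G\<^sub>0 p + H\<^sub>0 p \<and> 0 \<le> (left_push ?t p + right_push ?t p) / 2"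
      using U_le by eventually_elim (simp add: start_nonneg add_nonneg_nonneg)
    show "(\<integral>p. exp (- (x * (G\<^sub>0 p + H\<^sub>0 p - (a + b) * ?t + (left_push ?t p + right_push ?t p) / 2))) \<partial>Q)
        = (\<integral>p. exp (- (x * (G\<^sub>0 p + H\<^sub>0 p))) \<partial>Q)" for x
    proof -
      have "x * (G\<^sub>0 p - a * ?t - noise ?t p - right_push ?t p / 2 + left_push ?t p)
          + x * (H\<^sub>0 p - b * ?t + noise ?t p - left_push ?t p / 2 + right_push ?t p)
          = x * (G\<^sub>0 p + H\<^sub>0 p - (a + b) * ?t + (left_push ?t p + right_push ?t p) / 2)" for p
        by (simp add: field_simps)
      then show ?thesis using stat[of x x] by (simp only: distrib_left[symmetric])
    qed
  qed
  then have EU: "(\<integral>p. left_push ?t p + right_push ?t p \<partial>Q) \<le> 2 * \<bar>a + b\<bar> * ?t"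
    using r by (simp add: abs_mult)
  have "2 * \<bar>a + b\<bar> * ?t \<le> L * ?t"
  proof (intro mult_right_mono t)
    have "\<bar>a + b\<bar> \<le> \<bar>a\<bar> + \<bar>b\<bar>" by (rule abs_triangle_ineq)
    then have "2 * \<bar>a + b\<bar> \<le> 2 * (\<bar>a\<bar> + \<bar>b\<bar>)" by (rule mult_left_mono) simp
    then show "2 * \<bar>a + b\<bar> \<le> L" by (rule order_trans) (simp add: L_def)
  qed
  with EU have EU': "(\<integral>p. left_push ?t p + right_push ?t p \<partial>Q) \<le> L * ?t" by linarith
  have "stationary_step Q a b r L G\<^sub>0 H\<^sub>0 (noise ?t) (left_push ?t) (right_push ?t) n"
  proof (intro stationary_step.intro stationary_step_axioms.intro)
    show "AE p in Q. 0 \<le> G\<^sub>0 p \<and> 0 \<le> H\<^sub>0 p \<and> 0 \<le> left_push ?t p \<and> 0 \<le> right_push ?t p"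
      using U_le by eventually_elim (simp add: start_nonneg)
    show "AE p in Q. 0 \<le> G\<^sub>0 p - a * ?t - noise ?t p - right_push ?t p / 2 + left_push ?t p
        \<and> 0 \<le> H\<^sub>0 p - b * ?t + noise ?t p - left_push ?t p / 2 + right_push ?t p"
      using paths by eventually_elim (auto intro: path_bounds[OF t(2)])
    show "AE p in Q. \<bar>noise ?t p\<bar> \<le> n p \<and> ?t \<le> n p \<and> left_push ?t p + right_push ?t p \<le> L * n p
        \<and> (0 < left_push ?t p \<longrightarrow> G\<^sub>0 p \<le> L * n p) \<and> (0 < right_push ?t p \<longrightarrow> H\<^sub>0 p \<le> L * n p)"
      using paths
    proof eventually_elim
      case (elim p)
      then have p: "p \<in> space Q" and W: "\<forall>s\<in>{0..?t}. \<bar>W s (snd p)\<bar> \<le> N (snd p)" by auto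
      have "\<bar>W ?t (snd p)\<bar> \<le> N (snd p)" using bspec[OF W, of ?t] t(2) by simp
      then have "\<bar>noise ?t p\<bar> \<le> n p" using t(2) unfolding noise_def n_def by linarith
      then show ?case using path_bounds(5-7)[OF t(2) p W] N(2) by (simp add: n_def)
    qed
    show "1 \<le> L" by (simp add: L_def)
    show "0 < r" "r \<le> 1" by (fact r)+
    show "integrable Q (\<lambda>p. n p ^ 4)" "(\<integral>p. n p ^ 4 \<partial>Q) \<le> L * r ^ 8" by (fact i4 E4)+
    show "(\<integral>p. left_push ?t p + right_push ?t p \<partial>Q) \<le> L * ?t" by (fact EU')
    show "noise ?t \<in> borel_measurable Q" by (rule noise_measurable[OF t(2)])
    show "left_push ?t \<in> borel_measurable Q" "right_push ?t \<in> borel_measurable Q"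
      by (rule push_measurable[OF t(2)])+
    fix x y :: real assume xy: "0 \<le> x" "0 \<le> y"
    show "(\<integral>p. exp (- (x * (G\<^sub>0 p - a * ?t - noise ?t p - right_push ?t p / 2 + left_push ?t p)
        + y * (H\<^sub>0 p - b * ?t + noise ?t p - left_push ?t p / 2 + right_push ?t p))) \<partial>Q)
      = (\<integral>p. exp (- (x * G\<^sub>0 p + y * H\<^sub>0 p)) \<partial>Q)" by (rule stat)
    show "(\<integral>p. exp (- (x * G\<^sub>0 p + y * H\<^sub>0 p)) * noise ?t p \<partial>Q) = 0"
      by (rule laplace_noise(2)[OF xy t(1)])
    show "(\<integral>p. exp (- (x * G\<^sub>0 p + y * H\<^sub>0 p)) * (noise ?t p)\<^sup>2 \<partial>Q) = ?t * (\<integral>p. exp (- (x * G\<^sub>0 p + y * H\<^sub>0 p)) \<partial>Q)"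
      by (rule laplace_noise(3)[OF xy t(1)])
  qed (rule Q.P.prob_space_axioms start_measurable n)+
  then show thesis by (rule that)
qed

definition left_rate :: "real \<Rightarrow> real \<Rightarrow> real" where
  "left_rate r y = (\<integral>p. exp (- (y * H\<^sub>0 p)) * left_push (r ^ 4) p \<partial>Q) / r ^ 4"
definition right_rate :: "real \<Rightarrow> real \<Rightarrow> real" where
  "right_rate r x = (\<integral>p. exp (- (x * G\<^sub>0 p)) * right_push (r ^ 4) p \<partial>Q) / r ^ 4"

lemma rate_nonneg:
  assumes "0 < r"
  shows "0 \<le> left_rate r y" "0 \<le> right_rate r x"
proof -
  have "0 \<le> left_push (r ^ 4) p" "0 \<le> right_push (r ^ 4) p" if "p \<in> space Q" for p
  proof -
    have "snd p \<in> space M" using that by (auto simp: space_pair_measure)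
    then interpret path: regulated_path a b "G\<^sub>0 p" "H\<^sub>0 p" "\<lambda>t. W t (snd p)" "\<lambda>t. left_push t p" "\<lambda>t. right_push t p"
      unfolding left_push_def right_push_def by (intro regulated start_nonneg)
    show "0 \<le> left_push (r ^ 4) p" using assms by (intro path.A_nonneg) simp
    show "0 \<le> right_push (r ^ 4) p" using assms by (intro regulated_path.A_nonneg[OF path.swap]) simp
  qed
  then show "0 \<le> left_rate r y" "0 \<le> right_rate r x"
    unfolding left_rate_def right_rate_def
    using assms by (intro divide_nonneg_nonneg Bochner_Integration.integral_nonneg mult_nonneg_nonneg; simp)+
qed

lemma adjoint_relation:
  assumes xy: "0 \<le> x" "0 \<le> y"
  shows "((\<lambda>r. (x - y / 2) * left_rate r y + (y - x / 2) * right_rate r x) \<longlongrightarrow>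
    ((x - y)\<^sup>2 / 2 + a * x + b * y) * (\<integral>z. exp (- (x * max 0 (fst z) + y * max 0 (snd z))) \<partial>\<pi>)) (at_right 0)"
    (is "(?f \<longlongrightarrow> ?l) _")
proof -
  obtain K where K: "\<bar>?l - ?f r\<bar> \<le> K * r" if "0 < r" "r \<le> 1" for r
  proof
    fix r :: real assume r: "0 < r" "r \<le> 1"
    from stationary_step_at[OF r] obtain n where
      "stationary_step Q a b r L G\<^sub>0 H\<^sub>0 (noise (r ^ 4)) (left_push (r ^ 4)) (right_push (r ^ 4)) n" .
    from stationary_step.basic_relation[OF this xy]
    show "\<bar>?l - ?f r\<bar> \<le> (30 * ((1 + \<bar>a\<bar> + \<bar>b\<bar>) * (1 + x + y)) ^ 3 * L ^ 5) * r"
      unfolding laplace_noise(1)[OF xy zero_less_one] left_rate_def right_rate_def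
      by (simp only: diff_diff_eq)
  qed
  have "((\<lambda>r. ?f r - ?l) \<longlongrightarrow> 0) (at_right 0)"
  proof (rule Lim_null_comparison)
    show "((\<lambda>r. K * r) \<longlongrightarrow> 0) (at_right 0)"
      by (rule tendsto_mult_right_zero) (rule tendsto_ident_at)
    show "\<forall>\<^sub>F r in at_right 0. norm (?f r - ?l) \<le> K * r"
      using eventually_at_right_less eventually_at_right_real[OF zero_less_one]
      by eventually_elim (use K in \<open>auto simp: abs_minus_commute\<close>)
  qed
  then show ?thesis by (rule LIM_zero_cancel)
qed

lemma not_product: "\<pi> \<noteq> distr \<pi> borel fst \<Otimes>\<^sub>M distr \<pi> borel snd"
proof
  define \<mu> where "\<mu> = distr \<pi> borel fst"
  define \<nu> where "\<nu> = distr \<pi> borel snd"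
  assume "\<pi> = distr \<pi> borel fst \<Otimes>\<^sub>M distr \<pi> borel snd"
  then have prod: "\<pi> = \<mu> \<Otimes>\<^sub>M \<nu>" by (simp only: \<mu>_def \<nu>_def)
  have "fst \<in> borel_measurable (borel :: (real \<times> real) measure)" "snd \<in> borel_measurable (borel :: (real \<times> real) measure)"
    by (intro borel_measurable_continuous_onI continuous_intros)+
  then have meas: "fst \<in> borel_measurable \<pi>" "snd \<in> borel_measurable \<pi>"
    by (simp_all add: measurable_cong_sets[OF sets_\<pi> refl])
  interpret \<mu>: prob_space \<mu> unfolding \<mu>_def by (rule \<pi>.prob_space_distr[OF meas(1)])
  interpret \<nu>: prob_space \<nu> unfolding \<nu>_def by (rule \<pi>.prob_space_distr[OF meas(2)])
  interpret P: pair_prob_space \<mu> \<nu> ..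
  have sets[measurable_cong]: "sets \<mu> = sets borel" "sets \<nu> = sets borel" by (simp_all add: \<mu>_def \<nu>_def)
  define u where "u x = (\<integral>s. exp (- (x * max 0 s)) \<partial>\<mu>)" for x
  define v where "v y = (\<integral>s. exp (- (y * max 0 s)) \<partial>\<nu>)" for y
  have iu: "integrable \<mu> (\<lambda>s. exp (- (x * max 0 s)))" if "0 \<le> x" for x
    by (rule \<mu>.integrable_exp_minus) (use that in auto)
  have iv: "integrable \<nu> (\<lambda>s. exp (- (y * max 0 s)))" if "0 \<le> y" for y
    by (rule \<nu>.integrable_exp_minus) (use that in auto)
  have split: "(\<integral>z. exp (- (x * max 0 (fst z) + y * max 0 (snd z))) \<partial>\<pi>) = u x * v y" if "0 \<le> x" "0 \<le> y" for x y
  proof -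
    have "(\<integral>z. exp (- (x * max 0 (fst z) + y * max 0 (snd z))) \<partial>\<pi>)
        = (\<integral>z. exp (- (x * max 0 (fst z))) * exp (- (y * max 0 (snd z))) \<partial>\<pi>)"
      by (simp add: exp_add[symmetric])
    also have "\<dots> = u x * v y"
      unfolding prod u_def v_def using that by (intro P.integral_pair_times(2) iu iv)
    finally show ?thesis .
  qed
  show False
  proof (rule no_product_limit[where F=left_rate and G=right_rate and u=u and v=v and a=a and b=b])
    fix x y :: real assume "0 \<le> x" "0 \<le> y"
    from adjoint_relation[OF this]
    show "((\<lambda>r. (x - y / 2) * left_rate r y + (y - x / 2) * right_rate r x) \<longlongrightarrow>
        ((x - y)\<^sup>2 / 2 + a * x + b * y) * (u x * v y)) (at_right 0)"
      unfolding split[OF \<open>0 \<le> x\<close> \<open>0 \<le> y\<close>] .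
  next
    fix x :: real assume "0 \<le> x"
    then show "0 < u x" "0 < v x"
      unfolding u_def v_def by (intro \<mu>.expectation_greater \<nu>.expectation_greater iu iv AE_I2; simp)+
  qed (auto simp: rate_nonneg u_def v_def \<mu>.prob_space \<nu>.prob_space)
qed

end

theorem mainTheorem8:
  fixes M :: "'a measure"
    and W :: "real \<Rightarrow> 'a \<Rightarrow> real"
    and \<delta>\<^sub>1 \<delta>\<^sub>2 \<delta>\<^sub>3 :: real
    and A \<Gamma> :: "real \<Rightarrow> real \<Rightarrow> real \<Rightarrow> 'a \<Rightarrow> real"
    and \<pi> :: "(real \<times> real) measure"
  assumes "standard_brownian_motion M W"
    and "2 * (\<delta>\<^sub>3 - \<delta>\<^sub>2) + neg_part (\<delta>\<^sub>1 - \<delta>\<^sub>2) > 0"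
    and "2 * (\<delta>\<^sub>2 - \<delta>\<^sub>1) + neg_part (\<delta>\<^sub>2 - \<delta>\<^sub>3) > 0"
    and "\<And>g h. 0 \<le> g \<Longrightarrow> 0 \<le> h \<Longrightarrow>
           collision_local_times M W \<delta>\<^sub>1 \<delta>\<^sub>2 \<delta>\<^sub>3 g h (A g h) (\<Gamma> g h)"
    and "invariant_gap_distribution M W \<delta>\<^sub>1 \<delta>\<^sub>2 \<delta>\<^sub>3 A \<Gamma> \<pi>"
  shows "\<pi> \<noteq> distr \<pi> borel fst \<Otimes>\<^sub>M distr \<pi> borel snd"
proof -
  have "stationary_gaps M W \<delta>\<^sub>1 \<delta>\<^sub>2 \<delta>\<^sub>3 A \<Gamma> \<pi>"
    by (rule stationary_gaps.intro[OF assms(1) stationary_gaps_axioms.intro[OF assms(4,5)]])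
  then show ?thesis by (rule stationary_gaps.not_product)
qed

end
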